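(* Let $d\ge1$, $s\in(1,2)$, let $\varphi$ and $w$ be as in the context, and let $u:\mathbb{R}^d\to\mathbb{R}$ be the Perron function $$u(x)=\sup\{v(x):\ v:\mathbb{R}^d\to\mathbb{R},\ \varphi\le v\le\varphi+w\text{ and }\mathrm{MA}_s v\ge v-\varphi\text{ pointwise in }\mathbb{R}^d\}.$$ Then $u$ is itself a sub-solution, i.e. $$\mathrm{MA}_s u(x)\ge u(x)-\varphi(x)\qquad\text{for all }x\in\mathbb{R}^d.$$
   Context: An admissible kernel is a measurable function $K:\mathbb{R}^d\to[0,\infty]$ such that $|\{y:K(y)>r^{-d-s}\}|=|B_r|$ for every $r>0$. For $u:\mathbb{R}^d\to\mathbb{R}$, $\partial u(x)=\{b\in\mathbb{R}^d:u(z)\ge u(x)+b\cdot(z-x)\ \forall z\in\mathbb{R}^d\}$. Define $\mathrm{MA}_su(x)=-\infty$ if $\partial u(x)=\emptyset$, and otherwise $\mathrm{MA}_su(x)=\sup_{b\in\partial u(x)}\inf_{K\text{ admissible}}\int_{\mathbb{R}^d}(u(x+y)-u(x)-y\cdot b)K(y)\,dy\in[0,+\infty]$. Standing assumptions on $\varphi$: $\varphi:\mathbb{R}^d\to\mathbb{R}$ is smooth and strictly convex, $\sup|D^2\varphi|<\infty$, and $\lim_{R\to\infty}\varphi(Rx)/R=\Phi(x)$ for every $x$, where $\Phi$ is homogeneous of degree one and smooth away from the origin. The function $w$ is $w=-(I+(-\Delta)^{s/2})^{-1}(-\Delta)^{s/2}\varphi$, where $-(-\Delta)^{s/2}f(x)=\int_{\mathbb{R}^d}(f(x+y)-f(x)-y\cdot\nabla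 f(x))|y|^{-d-s}\,dy$; it is continuous, satisfies $0\le w(x)\le C(1+|x|)^{1-s}$ for some constant $C$, and $\varphi+w$ is a super-solution, i.e. $\mathrm{MA}_s(\varphi+w)\le w$ in $\mathbb{R}^d$. *)

theory Defs
  imports "HOL-Analysis.Analysis"
begin

text \<open>The recursion for \<open>C\<^sup>k\<close> is meant for open \<open>S\<close>: a function is
  \<open>C\<^sup>k\<^sup>+\<^sup>1\<close> iff it is differentiable and all its directional derivatives are \<open>C\<^sup>k\<close>.\<close>

primrec Ck_on :: "nat \<Rightarrow> (real^'n) set \<Rightarrow> (real^'n \<Rightarrow> real) \<Rightarrow> bool" where
  "Ck_on 0 S f \<longleftrightarrow> continuous_on S f"
| "Ck_on (Suc k) S f \<longleftrightarrow>
     (\<forall>x\<in>S. f differentiable (at x)) \<and>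
     (\<forall>v. Ck_on k S (\<lambda>x. frechet_derivative f (at x) v))"

definition smooth_on :: "(real^'n) set \<Rightarrow> (real^'n \<Rightarrow> real) \<Rightarrow> bool" where
  "smooth_on S f \<longleftrightarrow> (\<forall>k. Ck_on k S f)"

definition gradient :: "(real^'n \<Rightarrow> real) \<Rightarrow> real^'n \<Rightarrow> real^'n" where
  "gradient f x = (\<chi> i. frechet_derivative f (at x) (axis i 1))"

definition hessian :: "(real^'n \<Rightarrow> real) \<Rightarrow> real^'n \<Rightarrow> real^'n^'n" where
  "hessian f x = (\<chi> i j. frechet_derivative (\<lambda>z. gradient f z $ j) (at x) (axis i 1))"

definition strictly_convex :: "(real^'n \<Rightarrow> real) \<Rightarrow> bool" where
  "strictly_convex f \<longleftrightarrow>
     (\<forall>x y t. x \<noteq> y \<and> 0 < t \<and> t < 1 \<longrightarrow>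
        f ((1 - t) *\<^sub>R x + t *\<^sub>R y) < (1 - t) * f x + t * f y)"

definition standing_assms :: "(real^'n \<Rightarrow> real) \<Rightarrow> (real^'n \<Rightarrow> real) \<Rightarrow> bool" where
  "standing_assms \<phi> \<Phi> \<longleftrightarrow>
     smooth_on UNIV \<phi> \<and> strictly_convex \<phi> \<and> bounded (range (hessian \<phi>)) \<and>
     (\<forall>x. ((\<lambda>R::real. \<phi> (R *\<^sub>R x) / R) \<longlongrightarrow> \<Phi> x) at_top) \<and>
     (\<forall>x t. 0 < t \<longrightarrow> \<Phi> (t *\<^sub>R x) = t * \<Phi> x) \<and>
     smooth_on (UNIV - {0}) \<Phi>"

definition admissible_kernel :: "real \<Rightarrow> (real^'n \<Rightarrow> ennreal) \<Rightarrow> bool" where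
  "admissible_kernel s K \<longleftrightarrow>
     K \<in> borel_measurable lebesgue \<and>
     (\<forall>r>0. emeasure lebesgue {y. K y > ennreal (r powr (- real CARD('n) - s))} =
            emeasure lebesgue (ball (0::real^'n) r))"

definition subdifferential :: "(real^'n \<Rightarrow> real) \<Rightarrow> real^'n \<Rightarrow> (real^'n) set" where
  "subdifferential u x = {b. \<forall>z. u z \<ge> u x + b \<bullet> (z - x)}"

text \<open>For \<open>b\<close> in the subdifferential the first factor of the integrand is nonnegative, so
  \<open>ennreal\<close> does not truncate it.\<close>

definition MA :: "real \<Rightarrow> (real^'n \<Rightarrow> real) \<Rightarrow> real^'n \<Rightarrow> ereal" where
  "MA s u x =
     (if subdifferential u x = {} then -\<infinity>
      else (SUP b \<in> subdifferential u x. INF K \<in> {K. admissible_kernel s K}.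
              enn2ereal (\<integral>\<^sup>+ y. ennreal (u (x + y) - u x - y \<bullet> b) * K y \<partial>lebesgue)))"

definition frac_lap_integrand ::
    "real \<Rightarrow> (real^'n \<Rightarrow> real) \<Rightarrow> real^'n \<Rightarrow> real^'n \<Rightarrow> real" where
  "frac_lap_integrand s f x y =
     (f (x + y) - f x - y \<bullet> gradient f x) * norm y powr (- real CARD('n) - s)"

text \<open>\<open>frac_lap s f\<close> is \<open>(-\<Delta>)\<^sup>s\<^sup>/\<^sup>2 f\<close>, with kernel constant normalized to \<open>1\<close>;
  it is meaningful for \<open>f\<close> in \<open>frac_lap_domain s\<close>.\<close>

definition frac_lap :: "real \<Rightarrow> (real^'n \<Rightarrow> real) \<Rightarrow> real^'n \<Rightarrow> real" where
  "frac_lap s f x = - (\<integral> y. frac_lap_integrand s f x y \<partial>lebesgue)"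

definition frac_lap_domain :: "real \<Rightarrow> (real^'n \<Rightarrow> real) set" where
  "frac_lap_domain s =
     {f. \<forall>x. f differentiable (at x) \<and> integrable lebesgue (frac_lap_integrand s f x)}"

text \<open>\<open>is_frac_resolvent s g h\<close> says \<open>h = (I + (-\<Delta>)\<^sup>s\<^sup>/\<^sup>2)\<^sup>-\<^sup>1 g\<close>. The inverse is taken
  on bounded functions, where the maximum principle makes \<open>h\<close> unique.\<close>

definition is_frac_resolvent ::
    "real \<Rightarrow> (real^'n \<Rightarrow> real) \<Rightarrow> (real^'n \<Rightarrow> real) \<Rightarrow> bool" where
  "is_frac_resolvent s g h \<longleftrightarrow>
     bounded (range h) \<and> h \<in> frac_lap_domain s \<and> (\<forall>x. h x + frac_lap s h x = g x)"

definition perron_class ::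
    "real \<Rightarrow> (real^'n \<Rightarrow> real) \<Rightarrow> (real^'n \<Rightarrow> real) \<Rightarrow> (real^'n \<Rightarrow> real) set" where
  "perron_class s \<phi> w =
     {v. (\<forall>x. \<phi> x \<le> v x \<and> v x \<le> \<phi> x + w x) \<and> (\<forall>x. MA s v x \<ge> ereal (v x - \<phi> x))}"

text \<open>The real supremum is a genuine one when \<open>\<phi>\<close> is convex and differentiable and \<open>w \<ge> 0\<close>:
  then \<open>\<phi>\<close> belongs to the class, whose members are all bounded above by \<open>\<phi> + w\<close>.\<close>

definition perron :: "real \<Rightarrow> (real^'n \<Rightarrow> real) \<Rightarrow> (real^'n \<Rightarrow> real) \<Rightarrow> real^'n \<Rightarrow> real" where
  "perron s \<phi> w x = (SUP v \<in> perron_class s \<phi> w. v x)"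

end

theory Submission
  imports Defs
begin

text \<open>
  Fix \<open>x\<close>, an \<^emph>\<open>extreme\<close> point \<open>b\<close> of the subdifferential of \<open>u\<close> at \<open>x\<close> and an admissible \<open>K\<close>,
  and put \<open>g y = u (x + y) - u x - b \<bullet> y\<close>. We may assume that \<open>g K\<close> is integrable. Evaluating
  approximating sub-solutions \<open>v\<close> at \<open>x\<close> itself is useless, since \<open>v\<close> may have a tiny conical
  vertex there, which makes its operator infinite. Instead, integrability of \<open>g K\<close> produces, for small \<open>r\<close>,
  a height \<open>t = o(r\<^sup>s)\<close> such that the section \<open>{g \<le> t}\<close> has volume comparable to that of the ball of
  radius \<open>r\<close>. After an affine normalisation of the section, \<open>v\<close> is touched from above by a
  paraboloid of opening of order \<open>t\<close> at a point of a shrunken copy of the section, arbitrarily close to \<open>x\<close>.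
  There the operator applied to \<open>v\<close> is tested with a kernel that equals \<open>K\<close> (with the same base point
  as before) at scales above \<open>r\<close> and is adapted to the paraboloid at smaller scales; the latter
  part costs only \<open>O(t r\<^sup>-\<^sup>s)\<close>.

  The subgradient \<open>b + p\<close> of \<open>v\<close> at the touching point satisfies \<open>\<bar>p \<bullet> y\<bar> \<le> C max t (g y)\<close> by convexity. A
  limit \<open>p\<close> as \<open>t\<close> tends to \<open>0\<close> thus has \<open>b \<plusminus> p / C\<close> in the subdifferential, so \<open>p = 0\<close> because \<open>b\<close> is
  extreme, and dominated convergence removes the contribution of \<open>p\<close>.
\<close>

section \<open>Integrals of kernels\<close>

lemma borel_measurable_lebesgue_continuous:
  fixes f :: "'a::euclidean_space \<Rightarrow> 'b::topological_space"
  shows "continuous_on UNIV f \<Longrightarrow> f \<in> borel_measurable lebesgue"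
  by (intro measurable_completion) (simp add: borel_measurable_continuous_onI)

lemma admissible_kernel_measurable:
  "admissible_kernel s K \<Longrightarrow> K \<in> borel_measurable lebesgue"
  unfolding admissible_kernel_def by blast

lemma emeasure_lebesgue_ball:
  assumes "0 \<le> r"
  shows "emeasure lebesgue (ball (0::real^'n) r) =
    ennreal (unit_ball_vol (real CARD('n)) * r ^ CARD('n))"
  using emeasure_ball[OF assms, of "0::real^'n"] by simp

lemma emeasure_lebesgue_ball_powr:
  assumes "0 < r"
  shows "emeasure lebesgue (ball (0::real^'n) r) =
    ennreal (unit_ball_vol (real CARD('n)) * r powr real CARD('n))"
  using assms emeasure_lebesgue_ball[of r, where 'n='n] by (simp add: powr_realpow)

lemma suminf_ennreal_geometric:
  assumes "0 \<le> a" "0 \<le> q" "q < 1"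
  shows "(\<Sum>k. ennreal (a * q ^ k)) = ennreal (a / (1 - q))"
proof -
  have "(\<lambda>k. a * q ^ k) sums (a * (1 / (1 - q)))"
    using assms by (intro sums_mult geometric_sums) auto
  then show ?thesis
    using assms by (intro suminf_ennreal_eq) auto
qed

lemma term_le_suminf_ennreal: "f k \<le> (\<Sum>k. f k :: ennreal)"
  using sum_le_suminf[of f "{k}"] by simp

lemma power_powr_commute:
  fixes a :: real
  assumes "0 < a"
  shows "(a ^ k) powr e = (a powr e) ^ k"
  using assms by (induction k) (simp_all add: powr_mult)

lemma sets_lebesgue_Collect_less:
  fixes f g :: "'a::euclidean_space \<Rightarrow> 'b::{second_countable_topology, linorder_topology}"
  assumes [measurable]: "f \<in> borel_measurable lebesgue" "g \<in> borel_measurable lebesgue"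
  shows "{y. f y < g y} \<in> sets lebesgue"
proof -
  have "{y \<in> space lebesgue. f y < g y} \<in> sets lebesgue" by measurable
  then show ?thesis by simp
qed

text \<open>Dyadic layer cake: the set where \<open>K\<close> exceeds the level attached to the
  radius \<open>2 ^ Suc k * \<rho>\<close> has the volume of that ball, so the layers contribute a
  geometric series of ratio \<open>2 powr (- s)\<close>. Only the distribution of \<open>K\<close>
  enters, whence one \<open>A\<close> serves all admissible kernels.\<close>

lemma truncated_kernel_integral_bound:
  assumes "0 < s"
  obtains A where "0 \<le> A"
    "\<And>(K::real^'n \<Rightarrow> ennreal) \<rho>. \<lbrakk>admissible_kernel s K; 0 < \<rho>\<rbrakk> \<Longrightarrow>
      (\<integral>\<^sup>+y. min (K y) (ennreal (\<rho> powr (- real CARD('n) - s))) \<partial>lebesgue)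
        \<le> ennreal (A * \<rho> powr (- s))"
proof -
  define d where "d = real CARD('n)"
  define \<omega> where "\<omega> = unit_ball_vol d"
  have d: "0 \<le> d" and \<omega>: "0 \<le> \<omega>" by (auto simp: d_def \<omega>_def)
  define q where "q = (2::real) powr (- s)"
  have q: "0 \<le> q" "q < 1" using assms by (auto simp: q_def powr_less_one)
  define A where "A = \<omega> * 2 powr d / (1 - q)"
  have "0 \<le> A" using q \<omega> by (simp add: A_def)
  moreover have "(\<integral>\<^sup>+y. min (K y) (ennreal (\<rho> powr (- d - s))) \<partial>lebesgue) \<le> ennreal (A * \<rho> powr (- s))"
    if adm: "admissible_kernel s K" and \<rho>: "0 < \<rho>" for K :: "real^'n \<Rightarrow> ennreal" and \<rho>
  proof -
    have K[measurable]: "K \<in> borel_measurable lebesgue"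
      using adm unfolding admissible_kernel_def by blast
    have lev: "emeasure lebesgue {y. K y > ennreal (r powr (- d - s))} = ennreal (\<omega> * r powr d)"
      if "0 < r" for r
    proof -
      have "emeasure lebesgue {y. K y > ennreal (r powr (- d - s))} = emeasure lebesgue (ball (0::real^'n) r)"
        using adm that unfolding admissible_kernel_def d_def by blast
      then show ?thesis
        using emeasure_lebesgue_ball_powr[OF that, where 'n='n] by (simp only: d_def \<omega>_def)
    qed
    define \<kappa> where "\<kappa> k = ((2 ^ k * \<rho>) powr (- d - s))" for k :: nat
    have \<kappa>pos: "0 < \<kappa> k" for k using \<rho> by (simp add: \<kappa>_def)
    have \<kappa>0: "\<kappa> \<longlonglongrightarrow> 0"
    proof -
      have "\<kappa> = (\<lambda>k. \<rho> powr (- d - s) * (2 powr (- d - s)) ^ k)"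
        using \<rho> by (auto simp: \<kappa>_def powr_mult power_powr_commute)
      moreover have "(\<lambda>k. \<rho> powr (- d - s) * (2 powr (- d - s)) ^ k) \<longlonglongrightarrow> \<rho> powr (- d - s) * 0"
        using assms d by (intro tendsto_mult tendsto_const LIMSEQ_realpow_zero) (auto simp: powr_less_one)
      ultimately show ?thesis by simp
    qed
    have [measurable]: "{y. ennreal c < K y} \<in> sets lebesgue" for c
      by (intro sets_lebesgue_Collect_less) auto
    let ?T = "\<lambda>k y. ennreal (\<kappa> k) * indicator {y. K y > ennreal (\<kappa> (Suc k))} y"
    have pt: "min (K y) (ennreal (\<kappa> 0)) \<le> (\<Sum>k. ?T k y)" for y
    proof (cases "K y = 0")
      case False
      then have "0 < K y" by (simp add: zero_less_iff_neq_zero)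
      then obtain e' where e': "0 < e'" "e' < K y" using dense by blast
      then obtain e where e: "0 < e" "ennreal e < K y"
        by (cases e' rule: ennreal_cases) (auto simp: ennreal_less_zero_iff)
      have "\<forall>\<^sub>F k in sequentially. \<kappa> k < e"
        using \<kappa>0 e by (auto intro: order_tendstoD)
      then obtain m where "\<kappa> (Suc m) < e"
        by (meson eventually_sequentially le_Suc_eq order_refl)
      then have "ennreal (\<kappa> (Suc m)) < K y"
        using e le_less_trans[OF ennreal_leI[of "\<kappa> (Suc m)" e]] by simp
      then have ex: "\<exists>m. ennreal (\<kappa> (Suc m)) < K y" by blast
      \<comment> \<open>Minimality gives \<open>K y \<le> \<kappa> k\<close> if
        \<open>k > 0\<close>; for \<open>k = 0\<close> the truncation at \<open>\<kappa> 0\<close>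
        supplies the bound.\<close>
      define k where "k = (LEAST m. ennreal (\<kappa> (Suc m)) < K y)"
      have k: "ennreal (\<kappa> (Suc k)) < K y" unfolding k_def by (rule LeastI_ex[OF ex])
      have "min (K y) (ennreal (\<kappa> 0)) \<le> ennreal (\<kappa> k)"
      proof (cases k)
        case 0 then show ?thesis by simp
      next
        case (Suc j)
        then have "\<not> ennreal (\<kappa> (Suc j)) < K y"
          unfolding k_def by (metis lessI not_less_Least)
        then show ?thesis using Suc by (simp add: min.coboundedI1)
      qed
      also have "\<dots> = ?T k y" using k by simp
      also have "\<dots> \<le> (\<Sum>k. ?T k y)"
        by (rule term_le_suminf_ennreal)
      finally show ?thesis .
    qed simp
    have "(\<integral>\<^sup>+y. min (K y) (ennreal (\<kappa> 0)) \<partial>lebesgue) \<le> (\<integral>\<^sup>+y. (\<Sum>k. ?T k y) \<partial>lebesgue)"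
      by (intro nn_integral_mono pt)
    also have "\<dots> = (\<Sum>k. \<integral>\<^sup>+y. ?T k y \<partial>lebesgue)"
      by (intro nn_integral_suminf) measurable
    also have "\<dots> = (\<Sum>k. ennreal ((\<omega> * 2 powr d * \<rho> powr (- s)) * q ^ k))"
    proof (intro suminf_cong)
      fix k
      have "(\<integral>\<^sup>+y. ?T k y \<partial>lebesgue) = ennreal (\<kappa> k) * emeasure lebesgue {y. K y > ennreal (\<kappa> (Suc k))}"
        by (intro nn_integral_cmult_indicator) measurable
      also have "\<dots> = ennreal (\<kappa> k) * ennreal (\<omega> * (2 ^ Suc k * \<rho>) powr d)"
      proof -
        have "0 < 2 ^ Suc k * \<rho>" using \<rho> by simp
        from lev[OF this] show ?thesis unfolding \<kappa>_def by (rule arg_cong)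
      qed
      also have "\<dots> = ennreal (\<kappa> k * (\<omega> * (2 ^ Suc k * \<rho>) powr d))"
        using \<kappa>pos[of k] \<omega> by (subst ennreal_mult) auto
      also have "\<kappa> k * (\<omega> * (2 ^ Suc k * \<rho>) powr d) = (\<omega> * 2 powr d * \<rho> powr (- s)) * q ^ k"
      proof -
        have "(2 ^ Suc k * \<rho>) powr d = 2 powr d * (2 ^ k * \<rho>) powr d"
          using \<rho> by (simp add: powr_mult)
        moreover have "\<kappa> k * (2 ^ k * \<rho>) powr d = (2 ^ k * \<rho>) powr (- s)"
          by (simp add: \<kappa>_def powr_add[symmetric])
        moreover have "(2 ^ k * \<rho>) powr (- s) = q ^ k * \<rho> powr (- s)"
          using \<rho> by (simp add: q_def powr_mult power_powr_commute)
        ultimately show ?thesis by (simp add: mult_ac)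
      qed
      finally show "(\<integral>\<^sup>+y. ?T k y \<partial>lebesgue) = ennreal ((\<omega> * 2 powr d * \<rho> powr (- s)) * q ^ k)" .
    qed
    also have "\<dots> = ennreal ((\<omega> * 2 powr d * \<rho> powr (- s)) / (1 - q))"
      using q \<omega> by (intro suminf_ennreal_geometric) auto
    also have "(\<omega> * 2 powr d * \<rho> powr (- s)) / (1 - q) = A * \<rho> powr (- s)"
      by (simp add: A_def)
    finally show ?thesis by (simp add: \<kappa>_def)
  qed
  ultimately show thesis using that unfolding d_def by blast
qed

text \<open>The dyadic sum taken inwards, over shells between the radii
  \<open>\<sigma> (Suc k)\<close> and \<open>\<sigma> k\<close>; the ratio
  \<open>(1/2) powr (2 - s)\<close> is less than 1 because \<open>s < 2\<close>. Only the volumes of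
  the sublevel sets of \<open>N\<close> enter, so \<open>B\<close> is the same for all affinely
  distorted gauges.\<close>

lemma inner_kernel_integral_bound:
  assumes "0 < s" "s < 2"
  obtains B where "0 \<le> B"
    "\<And>(N::real^'n \<Rightarrow> real) \<rho>. \<lbrakk>N \<in> borel_measurable lebesgue; \<And>y. 0 \<le> N y; 0 < \<rho>;
       \<And>\<sigma>. 0 < \<sigma> \<Longrightarrow> emeasure lebesgue {y. N y < \<sigma>} = emeasure lebesgue (ball (0::real^'n) \<sigma>)\<rbrakk> \<Longrightarrow>
      (\<integral>\<^sup>+y. ennreal ((N y)\<^sup>2 * N y powr (- real CARD('n) - s)) * indicator {y. N y < \<rho>} y \<partial>lebesgue)
        \<le> ennreal (B * \<rho> powr (2 - s))"
proof -
  define d where "d = real CARD('n)"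
  define \<omega> where "\<omega> = unit_ball_vol d"
  have d: "0 \<le> d" and \<omega>: "0 \<le> \<omega>" by (auto simp: d_def \<omega>_def)
  define q where "q = (1/2::real) powr (2 - s)"
  have q: "0 \<le> q" "q < 1" using assms by (auto simp: q_def powr01_less_one)
  define B where "B = \<omega> * (1/2) powr (- d - s) / (1 - q)"
  have "0 \<le> B" using q \<omega> by (simp add: B_def)
  moreover have "(\<integral>\<^sup>+y. ennreal ((N y)\<^sup>2 * N y powr (- d - s)) * indicator {y. N y < \<rho>} y \<partial>lebesgue)
        \<le> ennreal (B * \<rho> powr (2 - s))"
    if N[measurable]: "N \<in> borel_measurable lebesgue" and N0: "\<And>y. 0 \<le> N y" and \<rho>: "0 < \<rho>"
      and lev0: "\<And>\<sigma>. 0 < \<sigma> \<Longrightarrow> emeasure lebesgue {y. N y < \<sigma>} = emeasure lebesgue (ball (0::real^'n) \<sigma>)"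
    for N :: "real^'n \<Rightarrow> real" and \<rho>
  proof -
    have lev: "\<And>\<sigma>. 0 < \<sigma> \<Longrightarrow> emeasure lebesgue {y. N y < \<sigma>} = ennreal (\<omega> * \<sigma> powr d)"
      unfolding lev0 d_def \<omega>_def by (rule emeasure_lebesgue_ball_powr)
    define \<sigma> where "\<sigma> k = (1/2) ^ k * \<rho>" for k :: nat
    have \<sigma>pos: "0 < \<sigma> k" for k using \<rho> by (simp add: \<sigma>_def)
    have \<sigma>0: "\<sigma> \<longlonglongrightarrow> 0"
      unfolding \<sigma>_def by (rule tendsto_mult_left_zero) (rule LIMSEQ_realpow_zero, auto)
    define \<kappa> where "\<kappa> k = (\<sigma> k)\<^sup>2 * (\<sigma> (Suc k)) powr (- d - s)" for k
    have \<kappa>pos: "0 \<le> \<kappa> k" for k by (simp add: \<kappa>_def)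
    have [measurable]: "{y. N y < c} \<in> sets lebesgue" for c
      by (intro sets_lebesgue_Collect_less) auto
    let ?T = "\<lambda>k y. ennreal (\<kappa> k) * indicator {y. N y < \<sigma> k} y"
    have pt: "ennreal ((N y)\<^sup>2 * N y powr (- d - s)) * indicator {y. N y < \<rho>} y \<le> (\<Sum>k. ?T k y)" for y
    proof (cases "0 < N y \<and> N y < \<rho>")
      case True
      have "\<forall>\<^sub>F k in sequentially. \<sigma> k < N y"
        using \<sigma>0 True by (auto intro: order_tendstoD)
      then obtain m where "\<sigma> (Suc m) < N y"
        by (meson eventually_sequentially le_Suc_eq order_refl)
      then have ex: "\<exists>m. \<sigma> (Suc m) \<le> N y" using less_imp_le by blast
      define k where "k = (LEAST m. \<sigma> (Suc m) \<le> N y)"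
      have k: "\<sigma> (Suc k) \<le> N y" unfolding k_def by (rule LeastI_ex[OF ex])
      have k2: "N y < \<sigma> k"
      proof (cases k)
        case 0 then show ?thesis using True by (simp add: \<sigma>_def)
      next
        case (Suc j)
        then have "\<not> \<sigma> (Suc j) \<le> N y"
          unfolding k_def by (metis lessI not_less_Least)
        then show ?thesis using Suc by simp
      qed
      have "(N y)\<^sup>2 * N y powr (- d - s) \<le> \<kappa> k"
        unfolding \<kappa>_def
      proof (intro mult_mono)
        show "N y powr (- d - s) \<le> \<sigma> (Suc k) powr (- d - s)"
          using k \<sigma>pos d assms by (intro powr_mono2') auto
      qed (use k2 N0 in \<open>auto intro!: power_mono\<close>)
      then have "ennreal ((N y)\<^sup>2 * N y powr (- d - s)) * indicator {y. N y < \<rho>} y \<le> ennreal (\<kappa> k)"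
        using True by (simp add: ennreal_leI)
      also have "\<dots> = ?T k y" using k2 by simp
      also have "\<dots> \<le> (\<Sum>k. ?T k y)"
        by (rule term_le_suminf_ennreal)
      finally show ?thesis .
    next
      case False
      then show ?thesis using N0[of y] by (auto simp: indicator_def)
    qed
    have "(\<integral>\<^sup>+y. ennreal ((N y)\<^sup>2 * N y powr (- d - s)) * indicator {y. N y < \<rho>} y \<partial>lebesgue)
        \<le> (\<integral>\<^sup>+y. (\<Sum>k. ?T k y) \<partial>lebesgue)"
      by (intro nn_integral_mono pt)
    also have "\<dots> = (\<Sum>k. \<integral>\<^sup>+y. ?T k y \<partial>lebesgue)"
      by (intro nn_integral_suminf) measurable
    also have "\<dots> = (\<Sum>k. ennreal ((\<omega> * (1/2) powr (- d - s) * \<rho> powr (2 - s)) * q ^ k))"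
    proof (intro suminf_cong)
      fix k
      have "(\<integral>\<^sup>+y. ?T k y \<partial>lebesgue) = ennreal (\<kappa> k) * emeasure lebesgue {y. N y < \<sigma> k}"
        by (intro nn_integral_cmult_indicator) measurable
      also have "\<dots> = ennreal (\<kappa> k * (\<omega> * \<sigma> k powr d))"
        using \<kappa>pos[of k] \<omega> lev[OF \<sigma>pos] by (subst ennreal_mult) auto
      also have "\<kappa> k * (\<omega> * \<sigma> k powr d) = (\<omega> * (1/2) powr (- d - s) * \<rho> powr (2 - s)) * q ^ k"
      proof -
        have "\<sigma> (Suc k) powr (- d - s) = (1/2) powr (- d - s) * \<sigma> k powr (- d - s)"
        proof -
          have "\<sigma> (Suc k) = (1/2) * \<sigma> k" by (simp add: \<sigma>_def)
          then show ?thesis using \<sigma>pos[of k] by (metis powr_mult zero_le_divide_1_iff zero_le_numeral less_imp_le)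
        qed
        moreover have "(\<sigma> k)\<^sup>2 * \<sigma> k powr (- d - s) * \<sigma> k powr d = \<sigma> k powr (2 - s)"
        proof -
          have "(\<sigma> k)\<^sup>2 = \<sigma> k powr 2" using \<sigma>pos[of k] by (simp add: powr_numeral)
          then show ?thesis by (simp only: powr_add[symmetric]) simp
        qed
        moreover have "\<sigma> k powr (2 - s) = q ^ k * \<rho> powr (2 - s)"
          using \<rho> by (simp add: \<sigma>_def q_def powr_mult power_powr_commute del: power_divide power_one_over)
        ultimately show ?thesis by (simp add: \<kappa>_def mult_ac)
      qed
      finally show "(\<integral>\<^sup>+y. ?T k y \<partial>lebesgue) = ennreal ((\<omega> * (1/2) powr (- d - s) * \<rho> powr (2 - s)) * q ^ k)" .
    qed
    also have "\<dots> = ennreal ((\<omega> * (1/2) powr (- d - s) * \<rho> powr (2 - s)) / (1 - q))"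
      using q \<omega> by (intro suminf_ennreal_geometric) auto
    also have "(\<omega> * (1/2) powr (- d - s) * \<rho> powr (2 - s)) / (1 - q) = B * \<rho> powr (2 - s)"
      by (simp add: B_def)
    finally show ?thesis .
  qed
  ultimately show thesis using that unfolding d_def by blast
qed

section \<open>Gluing admissible kernels\<close>

text \<open>The function \<open>f\<close> grows no faster than the volume of balls, hence is
  continuous, and it increases from 0 to the volume of \<open>X\<close>. So
  \<open>f (norm y)\<close> is uniformly distributed for \<open>y\<close> in
  \<open>X\<close>.\<close>

lemma emeasure_radial_sublevel:
  fixes X :: "(real^'n) set"
  assumes X: "X \<in> lmeasurable" and n: "0 \<le> n" "n \<le> measure lebesgue X"
  defines "f \<equiv> \<lambda>R. measure lebesgue (X \<inter> ball 0 R)"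
  shows "{y::real^'n. f (norm y) < n} \<in> sets borel"
    and "emeasure lebesgue {y \<in> X. f (norm y) < n} = ennreal n"
proof -
  have meas[simp]: "X \<inter> ball 0 R \<in> lmeasurable" for R
    using X by (intro fmeasurable.Int) auto
  have mono: "f R \<le> f R'" if "R \<le> R'" for R R'
    unfolding f_def using that by (intro measure_mono_fmeasurable) (auto intro: fmeasurableD)
  have f0: "f 0 = 0" by (simp add: f_def)
  have cont: "continuous_on {0..} f"
  proof -
    define V where "V R = measure lebesgue (ball (0::real^'n) R)" for R
    have le: "f R' - f R \<le> V R' - V R" if "0 \<le> R" "R \<le> R'" for R R'
    proof -
      have "f R' \<le> measure lebesgue ((X \<inter> ball 0 R) \<union> (ball 0 R' - ball (0::real^'n) R))"
        unfolding f_def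
        by (intro measure_mono_fmeasurable fmeasurable.Un fmeasurable.Diff) (auto intro: fmeasurableD)
      also have "\<dots> \<le> f R + measure lebesgue (ball 0 R' - ball (0::real^'n) R)"
        unfolding f_def by (intro measure_Un_le) (auto intro: fmeasurableD)
      also have "measure lebesgue (ball 0 R' - ball (0::real^'n) R) = V R' - V R"
        unfolding V_def using that by (intro measurable_measure_Diff) auto
      finally show ?thesis by simp
    qed
    have contV: "continuous_on {0..} V"
    proof -
      have "continuous_on {0..} (\<lambda>R. unit_ball_vol (real CARD('n)) * R ^ CARD('n))"
        by (intro continuous_intros)
      moreover have "unit_ball_vol (real CARD('n)) * R ^ CARD('n) = V R" if "R \<in> {0..}" for R
        using that content_ball[of R "0::real^'n"] by (simp add: V_def)
      ultimately show ?thesis by (rule continuous_on_eq)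
    qed
    have d: "dist (f R') (f R) \<le> dist (V R') (V R)" if "0 \<le> R" "0 \<le> R'" for R R'
      using le[of R R'] le[of R' R] mono[of R R'] mono[of R' R] that
      by (cases "R \<le> R'") (auto simp: dist_real_def)
    show ?thesis
      unfolding continuous_on_iff
    proof (intro ballI allI impI)
      fix R e assume R: "R \<in> {0::real..}" and e: "0 < (e::real)"
      from contV[unfolded continuous_on_iff, rule_format, OF R e]
      obtain \<delta> where \<delta>: "\<delta> > 0" "\<forall>R'\<in>{0..}. dist R' R < \<delta> \<longrightarrow> dist (V R') (V R) < e" by blast
      then show "\<exists>\<delta>>0. \<forall>R'\<in>{0..}. dist R' R < \<delta> \<longrightarrow> dist (f R') (f R) < e"
        using d R by (intro exI[of _ \<delta>]) (auto intro: le_less_trans)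
    qed
  qed
  have lim: "(\<lambda>k. f (real k)) \<longlonglongrightarrow> measure lebesgue X"
  proof -
    have U: "(\<Union>k. X \<inter> ball 0 (real k)) = X"
      by (auto simp: reals_Archimedean2)
    have "(\<lambda>k. measure lebesgue (X \<inter> ball 0 (real k))) \<longlonglongrightarrow> measure lebesgue (\<Union>k. X \<inter> ball 0 (real k))"
    proof (intro Lim_measure_incseq)
      show "emeasure lebesgue (\<Union>k. X \<inter> ball 0 (real k)) \<noteq> \<infinity>"
        using fmeasurableD2[OF X] by (simp only: U) simp
    qed (use fmeasurableD[OF meas] in \<open>auto simp: incseq_def\<close>)
    then show ?thesis by (simp only: f_def U)
  qed
  have "{y::real^'n. f (norm y) < n} \<in> sets borel \<and> emeasure lebesgue {y \<in> X. f (norm y) < n} = ennreal n"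
  proof (cases "n = 0")
    case True
    then have "\<not> f (norm y) < n" for y :: "real^'n" by (auto simp: f_def not_less)
    then show ?thesis using True by simp
  next
    case False
    then have npos: "0 < n" using n by simp
    show ?thesis
    proof (cases "\<forall>R\<ge>0. f R < n")
      \<comment> \<open>The value \<open>n\<close> is never reached, so it equals the limit of
        \<open>f\<close>, which is the full volume of \<open>X\<close>, and the sublevel set is the
        whole space.\<close>
      case True
      then have "measure lebesgue X \<le> n"
        by (intro LIMSEQ_le_const2[OF lim]) (auto intro!: exI[of _ 0] less_imp_le)
      then have "n = measure lebesgue X" using n by simp
      moreover have "f (norm y) < n" for y :: "real^'n" using True by auto
      ultimately show ?thesis using X by (simp add: emeasure_eq_measure2)
    next
      case False
      define Z where "Z = {R\<in>{0..}. n \<le> f R}"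
      have Z: "Z \<noteq> {}" "bdd_below Z" using False by (auto simp: Z_def not_less intro: bdd_belowI[of _ 0])
      have "closed Z"
      proof -
        have "Z = {0..} \<inter> f -` {n..}" by (auto simp: Z_def)
        then show ?thesis using continuous_closed_preimage[OF cont] by simp
      qed
      then have R0: "Inf Z \<in> Z" using Z closed_contains_Inf by blast
      define R0 where "R0 = Inf Z"
      have R00: "0 \<le> R0" "n \<le> f R0" using R0 by (auto simp: R0_def Z_def)
      \<comment> \<open>\<open>R0\<close> is the first radius at which \<open>f\<close> reaches
        \<open>n\<close>. The intermediate value theorem rules out an overshoot, and monotonicity
        makes the sublevel set an open ball.\<close>
      have less: "f R < n" if "0 \<le> R" "R < R0" for R
        using that cInf_lower[OF _ Z(2), of R] by (auto simp: Z_def R0_def not_le[symmetric])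
      have "f R0 = n"
      proof -
        obtain R where R: "0 \<le> R" "R \<le> R0" "f R = n"
          using IVT'[of f 0 n R0] f0 npos R00 continuous_on_subset[OF cont, of "{0..R0}"] by auto
        then show ?thesis using less[of R] by (cases "R = R0") auto
      qed
      moreover have "f (norm y) < n \<longleftrightarrow> y \<in> ball 0 R0" for y :: "real^'n"
        using less[of "norm y"] mono[of R0 "norm y"] R00 by (cases "norm y < R0") (auto simp: not_less)
      then have "{y::real^'n. f (norm y) < n} = ball 0 R0" "{y \<in> X. f (norm y) < n} = X \<inter> ball 0 R0" by blast+
      ultimately show ?thesis
        using meas[of R0] by (simp add: f_def emeasure_eq_measure2)
    qed
  qed
  then show "{y::real^'n. f (norm y) < n} \<in> sets borel"
    and "emeasure lebesgue {y \<in> X. f (norm y) < n} = ennreal n" by auto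
qed

text \<open>The function is the quantile function of \<open>K\<close> on \<open>Y\<close> composed with the uniformly distributed
  variable \<open>y \<mapsto> \<bar>X \<inter> B(0, \<bar>y\<bar>)\<bar>\<close> on \<open>X\<close>.\<close>

lemma exists_equidistributed_function:
  fixes X Y :: "(real^'n) set" and K :: "real^'n \<Rightarrow> ennreal"
  assumes X: "X \<in> lmeasurable" and Y: "Y \<in> lmeasurable"
    and XY: "measure lebesgue X = measure lebesgue Y"
    and K[measurable]: "K \<in> borel_measurable lebesgue"
    and c: "\<And>y. y \<in> Y \<Longrightarrow> K y \<le> c"
  obtains H where "H \<in> borel_measurable lebesgue"
    and "\<And>y. H y \<le> c"
    and "\<And>\<tau>. emeasure lebesgue {y \<in> X. \<tau> < H y} = emeasure lebesgue {y \<in> Y. \<tau> < K y}"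
proof -
  define U where "U y = measure lebesgue (X \<inter> ball 0 (norm y))" for y :: "real^'n"
  define N where "N \<tau> = measure lebesgue {y \<in> Y. \<tau> < K y}" for \<tau>
  define H where "H y = Sup {\<tau>. U y < N \<tau>}" for y
  have lev[simp]: "{y \<in> Y. \<tau> < K y} \<in> lmeasurable" for \<tau>
  proof -
    have "{y. \<tau> < K y} \<in> sets lebesgue" by (intro sets_lebesgue_Collect_less) auto
    then have "Y \<inter> {y. \<tau> < K y} \<in> lmeasurable" using Y by (rule fmeasurable_Int_fmeasurable[rotated])
    then show ?thesis by (simp add: Int_def)
  qed
  have N: "0 \<le> N \<tau>" "N \<tau> \<le> measure lebesgue X" for \<tau>
    unfolding N_def XY using Y by (auto intro!: measure_mono_fmeasurable intro: fmeasurableD)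
  have Nmono: "N \<tau>' \<le> N \<tau>" if "\<tau> \<le> \<tau>'" for \<tau> \<tau>'
    unfolding N_def using that by (intro measure_mono_fmeasurable) (auto intro: fmeasurableD)
  \<comment> \<open>Right continuity of the distribution function: the superlevel sets at levels
    slightly above \<open>\<tau>\<close> exhaust the one at \<open>\<tau>\<close>. This lets the
    equivalence for \<open>H\<close> below hold with strict inequalities on both sides.\<close>
  have Nright: "\<exists>\<tau>'. \<tau> < \<tau>' \<and> a < N \<tau>'" if a: "a < N \<tau>" "0 \<le> a" for a \<tau>
  proof -
    have "\<tau> \<noteq> top" using a by (auto simp: N_def)
    define F where "F k = {y \<in> Y. \<tau> + ennreal (inverse (real (Suc k))) < K y}" for k
    have "(\<Union>k. F k) = {y \<in> Y. \<tau> < K y}"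
    proof (intro equalityI subsetI)
      fix y assume y: "y \<in> {y \<in> Y. \<tau> < K y}"
      have "(\<lambda>k. \<tau> + ennreal (inverse (real (Suc k)))) \<longlonglongrightarrow> \<tau> + ennreal 0"
        by (intro tendsto_intros LIMSEQ_inverse_real_of_nat)
      then have "\<forall>\<^sub>F k in sequentially. \<tau> + ennreal (inverse (real (Suc k))) < K y"
        using y by (intro order_tendstoD) auto
      then obtain k where "\<tau> + ennreal (inverse (real (Suc k))) < K y"
        by (auto simp: eventually_sequentially)
      then show "y \<in> (\<Union>k. F k)" using y by (auto simp: F_def)
    next
      fix y assume "y \<in> (\<Union>k. F k)"
      then obtain k where "y \<in> Y" "\<tau> + ennreal (inverse (real (Suc k))) < K y" by (auto simp: F_def)
      then show "y \<in> {y \<in> Y. \<tau> < K y}"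
        using le_less_trans[of \<tau> "\<tau> + ennreal (inverse (real (Suc k)))" "K y"] by auto
    qed
    moreover have "incseq F"
    proof (intro incseq_SucI subsetI)
      fix k y assume "y \<in> F k"
      moreover have "\<tau> + ennreal (inverse (real (Suc (Suc k)))) \<le> \<tau> + ennreal (inverse (real (Suc k)))"
        by (intro add_left_mono ennreal_leI) (auto simp: field_simps)
      ultimately show "y \<in> F (Suc k)" unfolding F_def using le_less_trans by blast
    qed
    moreover have "range F \<subseteq> sets lebesgue"
      unfolding F_def using lev fmeasurableD by blast
    ultimately have "(\<lambda>k. measure lebesgue (F k)) \<longlonglongrightarrow> N \<tau>"
      using Lim_measure_incseq[of F lebesgue] lev[of \<tau>] by (auto simp: N_def fmeasurable_def)
    then have "\<forall>\<^sub>F k in sequentially. a < measure lebesgue (F k)"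
      using a by (intro order_tendstoD)
    then obtain k where "a < measure lebesgue (F k)" by (auto simp: eventually_sequentially)
    then have "a < N (\<tau> + ennreal (inverse (real (Suc k))))" by (simp add: N_def F_def)
    moreover have "\<tau> < \<tau> + ennreal (inverse (real (Suc k)))"
      using \<open>\<tau> \<noteq> top\<close> by (cases \<tau>) (auto simp: ennreal_plus[symmetric] ennreal_less_iff simp del: ennreal_plus)
    ultimately show ?thesis by blast
  qed
  have H: "\<tau> < H y \<longleftrightarrow> U y < N \<tau>" for \<tau> y
  proof
    assume "\<tau> < H y"
    then obtain \<tau>' where "\<tau> < \<tau>'" "U y < N \<tau>'" by (auto simp: H_def less_Sup_iff)
    then show "U y < N \<tau>" using Nmono[OF less_imp_le] less_le_trans by blast
  next
    assume "U y < N \<tau>"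
    then show "\<tau> < H y" using Nright[of "U y" \<tau>] by (auto simp: H_def less_Sup_iff U_def)
  qed
  show thesis
  proof
    show "H \<in> borel_measurable lebesgue"
    proof (rule borel_measurableI_greater)
      fix \<tau>
      have "{y. U y < N \<tau>} \<in> sets borel"
        unfolding U_def by (rule emeasure_radial_sublevel(1)[OF X N])
      then show "{x \<in> space lebesgue. \<tau> < H x} \<in> sets lebesgue"
        by (simp add: H)
    qed
    show "emeasure lebesgue {y \<in> X. \<tau> < H y} = emeasure lebesgue {y \<in> Y. \<tau> < K y}" for \<tau>
    proof -
      have "emeasure lebesgue {y \<in> X. \<tau> < H y} = ennreal (N \<tau>)"
        unfolding H U_def by (rule emeasure_radial_sublevel(2)[OF X N])
      also have "\<dots> = emeasure lebesgue {y \<in> Y. \<tau> < K y}"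
        unfolding N_def by (rule emeasure_eq_measure2[OF lev, symmetric])
      finally show ?thesis .
    qed
    show "H y \<le> c" for y
    proof (rule ccontr)
      assume "\<not> H y \<le> c"
      then have "U y < N c" using H by (simp add: not_le)
      moreover have "N c = 0" unfolding N_def using c by (metis (no_types, lifting) Collect_empty_eq leD measure_empty)
      ultimately show False by (simp add: U_def not_less)
    qed
  qed
qed

text \<open>Where \<open>K2\<close> overwrites \<open>K1\<close>, the lost values of \<open>K1\<close> are moved to the part of \<open>{\<kappa> < K1}\<close> that is left free;
  both regions have the same measure.\<close>

lemma admissible_kernel_glue:
  fixes K1 K2 :: "real^'n \<Rightarrow> ennreal"
  assumes K1: "admissible_kernel s K1" and K2: "admissible_kernel s K2" and \<rho>: "0 < \<rho>" and s: "0 < s"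
  defines "\<kappa> \<equiv> ennreal (\<rho> powr (- real CARD('n) - s))"
  obtains K3 where "admissible_kernel s K3"
    "\<And>y. K3 y \<le> min (K1 y) \<kappa> + K2 y * indicator {y. \<kappa> < K2 y} y"
proof -
  have m[measurable]: "K1 \<in> borel_measurable lebesgue" "K2 \<in> borel_measurable lebesgue"
    using K1 K2 unfolding admissible_kernel_def by blast+
  have lev[measurable]: "{y. \<tau> < K1 y} \<in> sets lebesgue" "{y. \<tau> < K2 y} \<in> sets lebesgue" for \<tau>
    by (intro sets_lebesgue_Collect_less; simp)+
  define E where "E = {y. \<kappa> < K1 y}"
  define A where "A = {y. \<kappa> < K2 y}"
  have eE: "emeasure lebesgue E = emeasure lebesgue (ball (0::real^'n) \<rho>)"
    and eA: "emeasure lebesgue A = emeasure lebesgue (ball (0::real^'n) \<rho>)"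
    using K1 K2 \<rho> unfolding admissible_kernel_def E_def A_def \<kappa>_def by blast+
  have fin: "emeasure lebesgue (ball (0::real^'n) \<rho>) < \<infinity>"
    using \<rho> by (subst emeasure_lebesgue_ball) auto
  have EA: "E \<in> lmeasurable" "A \<in> lmeasurable"
    using eE eA fin lev unfolding E_def A_def fmeasurable_def by auto
  have eq: "measure lebesgue E = measure lebesgue A"
    using eE eA by (simp add: measure_def)
  have XY: "E - A \<in> lmeasurable" "A - E \<in> lmeasurable" "E \<inter> A \<in> lmeasurable"
    using EA by (auto intro: fmeasurable.Diff fmeasurableD)
  \<comment> \<open>\<open>E\<close> and \<open>A\<close> have equal finite volume, so removing
    their intersection leaves equal volumes, as the rearrangement requires.\<close>
  have "measure lebesgue (E - A) = measure lebesgue (A - E)"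
    using eq measurable_measure_Diff[of "E" lebesgue "E \<inter> A"] measurable_measure_Diff[of "A" lebesgue "E \<inter> A"] XY EA
    by (simp add: Diff_Int fmeasurableD)
  moreover have "K1 y \<le> \<kappa>" if "y \<in> A - E" for y using that by (simp add: E_def not_less)
  ultimately obtain H where H[measurable]: "H \<in> borel_measurable lebesgue" and Hc: "\<And>y. H y \<le> \<kappa>"
    and Hl: "\<And>\<tau>. emeasure lebesgue {y \<in> E - A. \<tau> < H y} = emeasure lebesgue {y \<in> A - E. \<tau> < K1 y}"
    using exists_equidistributed_function[OF XY(1,2) _ m(1), of \<kappa>] by blast
  have [measurable]: "E \<in> sets lebesgue" "A \<in> sets lebesgue" using EA by (auto intro: fmeasurableD)
  have Hlev: "{y. \<tau> < H y} \<in> sets lebesgue" for \<tau>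
    by (intro sets_lebesgue_Collect_less; simp)
  define K3 where "K3 y = (if y \<in> A then K2 y else if y \<in> E then H y else K1 y)" for y
  show thesis
  proof
    show "K3 y \<le> min (K1 y) \<kappa> + K2 y * indicator {y. \<kappa> < K2 y} y" for y
      using Hc[of y] by (auto simp: K3_def A_def E_def not_less min_def intro: order_trans)
    show "admissible_kernel s K3"
      unfolding admissible_kernel_def
    proof (intro conjI allI impI)
      show "K3 \<in> borel_measurable lebesgue"
        unfolding K3_def by measurable
      fix r :: real assume r: "0 < r"
      define \<tau> where "\<tau> = ennreal (r powr (- real CARD('n) - s))"
      have l1: "emeasure lebesgue {y. \<tau> < K1 y} = emeasure lebesgue (ball (0::real^'n) r)"
        and l2: "emeasure lebesgue {y. \<tau> < K2 y} = emeasure lebesgue (ball (0::real^'n) r)"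
        using K1 K2 r unfolding admissible_kernel_def \<tau>_def by blast+
      have "emeasure lebesgue {y. \<tau> < K3 y} = emeasure lebesgue (ball (0::real^'n) r)"
      proof (cases "r \<le> \<rho>")
        case True
        \<comment> \<open>Above the level \<open>\<kappa>\<close> only \<open>K2\<close> is visible:
          \<open>H\<close> is at most \<open>\<kappa>\<close>, and so is \<open>K1\<close> off
          \<open>E\<close>.\<close>
        then have "\<kappa> \<le> \<tau>"
          unfolding \<kappa>_def \<tau>_def using r s by (intro ennreal_leI powr_mono2') auto
        then have "\<tau> < K3 y \<longleftrightarrow> \<tau> < K2 y" for y
          using Hc[of y] by (auto simp: K3_def A_def E_def not_less)
        then show ?thesis using l2 by simp
      next
        case False
        have "r powr (- real CARD('n) - s) < \<rho> powr (- real CARD('n) - s)"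
          using False \<rho> s by (intro powr_less_mono2_neg) auto
        then have \<tau>\<kappa>: "\<tau> < \<kappa>" unfolding \<kappa>_def \<tau>_def by (intro ennreal_lessI) (use \<rho> in auto)
        \<comment> \<open>Below the level \<open>\<kappa>\<close> the superlevel set of
          \<open>K1\<close> consists of \<open>E\<close>, \<open>P\<close> and \<open>Q\<close>,
          that of \<open>K3\<close> of \<open>A\<close>, \<open>P\<close> and \<open>Q'\<close>;
          corresponding pieces have equal volume.\<close>
        define P where "P = {y. \<tau> < K1 y} - (A \<union> E)"
        define Q where "Q = {y \<in> A - E. \<tau> < K1 y}"
        define Q' where "Q' = {y \<in> E - A. \<tau> < H y}"
        have PQ[measurable]: "P \<in> sets lebesgue" "Q \<in> sets lebesgue" "Q' \<in> sets lebesgue"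
        proof -
          have "Q = (A - E) \<inter> {y. \<tau> < K1 y}" "Q' = (E - A) \<inter> {y. \<tau> < H y}" by (auto simp: Q_def Q'_def)
          then show "P \<in> sets lebesgue" "Q \<in> sets lebesgue" "Q' \<in> sets lebesgue"
            using lev Hlev EA by (auto simp: P_def intro: fmeasurableD)
        qed
        have "{y. \<tau> < K3 y} = A \<union> (P \<union> Q')"
          using \<tau>\<kappa> by (auto simp: K3_def P_def Q'_def A_def)
        then have "emeasure lebesgue {y. \<tau> < K3 y} = emeasure lebesgue A + (emeasure lebesgue P + emeasure lebesgue Q')"
        proof -
          have "emeasure lebesgue P + emeasure lebesgue Q' = emeasure lebesgue (P \<union> Q')"
            by (intro plus_emeasure) (auto simp: P_def Q'_def)
          moreover have "emeasure lebesgue A + emeasure lebesgue (P \<union> Q') = emeasure lebesgue (A \<union> (P \<union> Q'))"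
            by (intro plus_emeasure) (auto simp: P_def Q'_def)
          ultimately show ?thesis using \<open>{y. \<tau> < K3 y} = A \<union> (P \<union> Q')\<close> by simp
        qed
        also have "\<dots> = emeasure lebesgue E + (emeasure lebesgue P + emeasure lebesgue Q)"
          using Hl[of \<tau>] eE eA by (simp add: Q_def Q'_def)
        also have "\<dots> = emeasure lebesgue (E \<union> (P \<union> Q))"
        proof -
          have "emeasure lebesgue P + emeasure lebesgue Q = emeasure lebesgue (P \<union> Q)"
            by (intro plus_emeasure) (auto simp: P_def Q_def)
          moreover have "emeasure lebesgue E + emeasure lebesgue (P \<union> Q) = emeasure lebesgue (E \<union> (P \<union> Q))"
            by (intro plus_emeasure) (auto simp: P_def Q_def)
          ultimately show ?thesis by simp
        qed
        also have "E \<union> (P \<union> Q) = {y. \<tau> < K1 y}"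
          using \<tau>\<kappa> by (auto simp: P_def Q_def E_def)
        finally show ?thesis using l1 by simp
      qed
      then show "emeasure lebesgue {y. ennreal (r powr (- real CARD('n) - s)) < K3 y} =
          emeasure lebesgue (ball (0::real^'n) r)" by (simp only: \<tau>_def)
    qed
  qed
qed

section \<open>Translation invariance of integrals and of admissibility\<close>

lemma lebesgue_translation:
  fixes a :: "'a::euclidean_space"
  shows measurable_lebesgue_translation: "(+) a \<in> lebesgue \<rightarrow>\<^sub>M lebesgue"
    and distr_lebesgue_translation: "distr lebesgue lebesgue ((+) a) = lebesgue"
proof -
  have eq: "(\<lambda>x. a + (\<Sum>j\<in>Basis. (1 * (x \<bullet> j)) *\<^sub>R j)) = (+) a"
    by (auto simp: euclidean_representation)
  show "(+) a \<in> lebesgue \<rightarrow>\<^sub>M lebesgue"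
    using lebesgue_affine_measurable[of "\<lambda>_. 1" a] unfolding eq by simp
  have "lebesgue = density (distr lebesgue lebesgue ((+) a)) (\<lambda>_. 1)"
    using lebesgue_affine_euclidean[of "\<lambda>_. 1" a] unfolding eq by simp
  then show "distr lebesgue lebesgue ((+) a) = lebesgue" by (simp add: density_1)
qed

lemma nn_integral_lebesgue_translation:
  fixes f :: "'a::euclidean_space \<Rightarrow> ennreal"
  assumes f: "f \<in> borel_measurable lebesgue"
  shows "(\<integral>\<^sup>+y. f (a + y) \<partial>lebesgue) = (\<integral>\<^sup>+y. f y \<partial>lebesgue)"
proof -
  have "(\<integral>\<^sup>+y. f y \<partial>lebesgue) = (\<integral>\<^sup>+y. f y \<partial>distr lebesgue lebesgue ((+) a))"
    by (simp add: distr_lebesgue_translation)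
  also have "\<dots> = (\<integral>\<^sup>+y. f (a + y) \<partial>lebesgue)"
    using f by (intro nn_integral_distr measurable_lebesgue_translation)
      (simp add: distr_lebesgue_translation)
  finally show ?thesis by simp
qed

text \<open>Admissibility constrains only the distribution of a kernel. Hence a kernel centred at
  one point may be used to test the operator at a nearby one.\<close>

lemma admissible_kernel_translation:
  fixes K :: "real^'n \<Rightarrow> ennreal"
  assumes K: "admissible_kernel s K"
  shows "admissible_kernel s (\<lambda>y. K (a + y))"
proof -
  note Km[measurable] = admissible_kernel_measurable[OF K]
  note tm[measurable] = measurable_lebesgue_translation[of a]
  have "emeasure lebesgue {y. c < K (a + y)} = emeasure lebesgue {y. c < K y}" for c
  proof -
    have "{y. c < K y} \<in> sets lebesgue" by (intro sets_lebesgue_Collect_less) auto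
    then have "emeasure (distr lebesgue lebesgue ((+) a)) {y. c < K y}
        = emeasure lebesgue ((+) a -` {y. c < K y} \<inter> space lebesgue)"
      by (intro emeasure_distr tm)
    then show ?thesis by (simp add: distr_lebesgue_translation vimage_def)
  qed
  moreover have "(\<lambda>y. K (a + y)) \<in> borel_measurable lebesgue"
    using measurable_compose[OF tm Km] .
  ultimately show ?thesis using K unfolding admissible_kernel_def by presburger
qed

section \<open>Touching a convex function inside a section\<close>

text \<open>Supplies the compact feasible set on which the determinant attains its maximum.\<close>

lemma compact_matrix_rows:
  fixes S :: "(real^'n) set"
  assumes "compact S"
  shows "compact {Y :: real^'n^'m. \<forall>i. Y $ i \<in> S}"
proof -
  have "bounded {Y :: real^'n^'m. \<forall>i. Y $ i \<in> S}"
  proof -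
    obtain B where B: "\<And>y. y \<in> S \<Longrightarrow> norm y \<le> B"
      using assms compact_imp_bounded bounded_iff by metis
    have "norm Y \<le> (\<Sum>i\<in>(UNIV::'m set). B)" if "\<forall>i. Y $ i \<in> S" for Y :: "real^'n^'m"
    proof -
      have "norm Y \<le> (\<Sum>i\<in>UNIV. norm (Y $ i))"
        unfolding norm_vec_def by (rule L2_set_le_sum) auto
      also have "\<dots> \<le> (\<Sum>i\<in>(UNIV::'m set). B)" using B that by (intro sum_mono) auto
      finally show ?thesis .
    qed
    then show ?thesis unfolding bounded_iff by blast
  qed
  moreover have "closed {Y :: real^'n^'m. \<forall>i. Y $ i \<in> S}"
  proof (intro closed_Collect_all)
    fix i :: 'm
    have "closed ((\<lambda>Y :: real^'n^'m. Y $ i) -` S)"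
      using compact_imp_closed[OF assms] by (rule closed_vimage) (intro continuous_intros)
    then show "closed {Y :: real^'n^'m. Y $ i \<in> S}" by (simp add: vimage_def)
  qed
  ultimately show ?thesis by (simp add: compact_eq_bounded_closed)
qed

text \<open>Vectors of \<open>S\<close> spanning a parallelepiped of maximal volume; the coordinate bound is
  Cramer's rule. Unlike John's ellipsoid, this normalisation keeps the vectors inside \<open>S\<close>.\<close>

lemma maximal_basis_in_compact_set:
  fixes S :: "(real^'n) set"
  assumes S: "compact S" and e: "0 < e" "cball 0 e \<subseteq> S"
  obtains T Ti :: "real^'n \<Rightarrow> real^'n"
  where "linear T" "linear Ti" "\<And>x. T (Ti x) = x" "\<And>x. Ti (T x) = x"
    "\<And>i. T (axis i 1) \<in> S" "\<And>z i. z \<in> S \<Longrightarrow> \<bar>Ti z $ i\<bar> \<le> 1"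
proof -
  let ?R = "{Y :: real^'n^'n. \<forall>i. Y $ i \<in> S}"
  \<comment> \<open>A feasible matrix of nonzero determinant, which keeps the maximiser
    nonsingular.\<close>
  define Y0 :: "real^'n^'n" where "Y0 = (\<chi> i. e *\<^sub>R axis i 1)"
  have Y0: "Y0 \<in> ?R" using e by (auto simp: Y0_def)
  have "det Y0 = (\<Prod>i\<in>UNIV. Y0 $ i $ i)" by (rule det_diagonal) (simp add: Y0_def axis_def)
  then have detY0: "det Y0 \<noteq> 0" using e by (simp add: Y0_def)
  have "continuous_on ?R (\<lambda>Y. \<bar>det Y\<bar>)"
    unfolding det_def by (intro continuous_intros)
  from continuous_attains_sup[OF compact_matrix_rows[OF S] _ this] Y0
  obtain Y where Y: "Y \<in> ?R" and max: "\<And>Y'. Y' \<in> ?R \<Longrightarrow> \<bar>det Y'\<bar> \<le> \<bar>det Y\<bar>" by blast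
  have detY: "det Y \<noteq> 0" using max[OF Y0] detY0 by auto
  then obtain B where B: "transpose Y ** B = mat 1" "B ** transpose Y = mat 1"
    using invertible_det_nz[of "transpose Y"] by (auto simp: det_transpose invertible_def)
  define T where "T = (\<lambda>x. transpose Y *v x)"
  define Ti where "Ti = (\<lambda>x. B *v x)"
  have Trow: "T x = (\<Sum>i\<in>UNIV. x $ i *s row i Y)" for x
    by (simp add: T_def matrix_mult_sum)
  have inv: "T (Ti x) = x" "Ti (T x) = x" for x
    by (simp_all only: T_def Ti_def matrix_vector_mul_assoc B matrix_vector_mul_lid)
  show thesis
  proof
    show "linear T" "linear Ti" unfolding T_def Ti_def by (rule matrix_vector_mul_linear)+
    show "T (Ti x) = x" "Ti (T x) = x" for x by (fact inv)+
    show "T (axis i 1) \<in> S" for i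
    proof -
      have "T (axis i 1) = Y $ i"
        unfolding T_def matrix_vector_mult_basis column_transpose by (simp add: row_def)
      then show ?thesis using Y by simp
    qed
    show "\<bar>Ti z $ k\<bar> \<le> 1" if z: "z \<in> S" for z k
    proof -
      define Y' where "Y' = (\<chi> i. if i = k then z else row i Y)"
      have zsum: "(\<Sum>i\<in>UNIV. Ti z $ i *s row i Y) = z" using Trow[of "Ti z"] inv by simp
      have "det Y' = Ti z $ k * det Y"
        using cramer_lemma_transpose[of k "Ti z" Y] unfolding zsum Y'_def .
      moreover have "Y' \<in> ?R" using Y z by (auto simp: Y'_def row_def)
      ultimately have "\<bar>Ti z $ k\<bar> * \<bar>det Y\<bar> \<le> 1 * \<bar>det Y\<bar>" using max[of Y'] by (simp add: abs_mult)
      then show ?thesis using detY by simp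
    qed
  qed
qed

text \<open>All these sublevel sets are dilated translates of \<open>G\<close>, the image of the
  unit ball under \<open>T\<close>; the volume of \<open>G\<close> plays the role of the determinant
  of \<open>T\<close>.\<close>

lemma linear_gauge_ball_measure:
  fixes T Ti :: "real^'n \<Rightarrow> real^'n"
  assumes T: "linear T" "linear Ti" "\<And>x. T (Ti x) = x" "\<And>x. Ti (T x) = x"
  defines "G \<equiv> {y. norm (Ti y) < 1}"
  shows "G \<in> lmeasurable"
    and "0 < c \<Longrightarrow> emeasure lebesgue {y. norm (Ti (y - \<xi>)) < c} = ennreal (c ^ CARD('n) * measure lebesgue G)"
proof -
  have contTi: "continuous_on UNIV Ti" using T(2) linear_continuous_on linear_linear by blast
  have "G = T ` ball 0 1"
  proof (intro equalityI subsetI)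
    fix y assume "y \<in> G"
    then show "y \<in> T ` ball 0 1" using T(3)[of y] by (intro image_eqI[of _ _ "Ti y"]) (auto simp: G_def)
  qed (auto simp: G_def T(4))
  moreover have "bounded (T ` ball 0 1)"
    using T(1) by (intro bounded_linear_image) (auto simp: linear_linear)
  moreover have "open G"
    unfolding G_def by (intro open_Collect_less continuous_intros contTi)
  ultimately show G: "G \<in> lmeasurable" using lmeasurable_open by simp
  assume c: "0 < c"
  have "{y. norm (Ti (y - \<xi>)) < c} = (\<lambda>x. c *\<^sub>R x + \<xi>) ` G"
  proof (intro equalityI subsetI)
    fix y assume y: "y \<in> {y. norm (Ti (y - \<xi>)) < c}"
    have "Ti ((1/c) *\<^sub>R (y - \<xi>)) = (1/c) *\<^sub>R Ti (y - \<xi>)" using T(2) by (rule linear_scale)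
    then have "(1/c) *\<^sub>R (y - \<xi>) \<in> G" using y c by (simp add: G_def)
    then show "y \<in> (\<lambda>x. c *\<^sub>R x + \<xi>) ` G" using c by (intro image_eqI[of _ _ "(1/c) *\<^sub>R (y - \<xi>)"]) auto
  next
    fix y assume "y \<in> (\<lambda>x. c *\<^sub>R x + \<xi>) ` G"
    then obtain x where x: "norm (Ti x) < 1" "y = c *\<^sub>R x + \<xi>" by (auto simp: G_def)
    have "Ti (c *\<^sub>R x) = c *\<^sub>R Ti x" using T(2) by (rule linear_scale)
    then show "y \<in> {y. norm (Ti (y - \<xi>)) < c}" using x c by simp
  qed
  then show "emeasure lebesgue {y. norm (Ti (y - \<xi>)) < c} = ennreal (c ^ CARD('n) * measure lebesgue G)"
    using emeasure_lebesgue_affine[of c \<xi> G] c G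
    by (simp add: emeasure_eq_measure2 ennreal_mult ennreal_power)
qed

text \<open>A short step along \<open>p - q\<close> makes the linear gap between the two slopes beat
  the quadratic term. Touching by a paraboloid from above thus determines the subgradient.\<close>

lemma touching_paraboloid_subgradient:
  fixes f :: "'a::real_inner \<Rightarrow> real"
  assumes \<eta>: "0 < \<eta>" and M: "0 \<le> M"
    and sub: "\<And>\<zeta>. norm \<zeta> \<le> \<eta> \<Longrightarrow> p \<bullet> \<zeta> \<le> f \<zeta>"
    and up: "\<And>\<zeta>. norm \<zeta> \<le> \<eta> \<Longrightarrow> f \<zeta> \<le> q \<bullet> \<zeta> + M * (norm \<zeta>)\<^sup>2"
  shows "p = q"
proof (rule ccontr)
  assume "p \<noteq> q"
  define e where "e = p - q"
  have e: "0 < norm e" using \<open>p \<noteq> q\<close> by (simp add: e_def)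
  \<comment> \<open>The first bound keeps the test vector in the ball of radius
    \<open>\<eta>\<close>, the second makes \<open>M * \<tau>\<close> less than 1.\<close>
  define \<tau> where "\<tau> = min (\<eta> / norm e) (1 / (2 * (M + 1)))"
  have \<tau>: "0 < \<tau>" using \<eta> e M by (simp add: \<tau>_def)
  have "\<tau> * norm e \<le> \<eta> / norm e * norm e" using e by (intro mult_right_mono) (auto simp: \<tau>_def)
  then have n: "norm (\<tau> *\<^sub>R e) \<le> \<eta>" using e \<tau> by simp
  from sub[OF n] up[OF n] have "e \<bullet> (\<tau> *\<^sub>R e) \<le> M * (norm (\<tau> *\<^sub>R e))\<^sup>2"
    by (simp add: e_def inner_diff_left right_diff_distrib)
  then have "\<tau> * (norm e)\<^sup>2 \<le> (M * \<tau>) * (\<tau> * (norm e)\<^sup>2)"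
    using \<tau> by (simp add: dot_square_norm power_mult_distrib power2_eq_square mult_ac)
  moreover have "M * \<tau> < 1"
  proof -
    have "M * \<tau> \<le> M * (1 / (2 * (M + 1)))" using M by (intro mult_left_mono) (auto simp: \<tau>_def)
    also have "\<dots> < 1" using M by (simp add: field_simps)
    finally show ?thesis .
  qed
  moreover have "0 < \<tau> * (norm e)\<^sup>2" using \<tau> e by simp
  ultimately show False using mult_strict_right_mono[of "M * \<tau>" 1 "\<tau> * (norm e)\<^sup>2"] by linarith
qed

text \<open>In coordinates that normalise the section, a paraboloid is subtracted from
  \<open>h\<close> and the difference is maximised over a ball inside a shrunken corner of the
  section. The maximiser is interior, so every subgradient there comes from the gradient of the
  paraboloid. \<open>N\<close> is the distance to the touching point in these coordinates, scaled so
  that its balls have Euclidean volume; \<open>vol\<close> bounds its distortion relative to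
  \<open>r\<close>.\<close>

lemma convex_section_touching:
  fixes g h :: "real^'n \<Rightarrow> real" and d \<epsilon> \<eta> :: real
  defines "d \<equiv> real CARD('n)" and "\<eta> \<equiv> \<epsilon> / (2 * real CARD('n))"
  assumes g: "convex_on UNIV g" "\<And>y. 0 \<le> g y" "g 0 = 0"
    and t: "0 < t" and D: "\<And>y. g y \<le> t \<Longrightarrow> norm y \<le> D"
    and \<epsilon>: "0 < \<epsilon>" "\<epsilon> \<le> 1" and r: "0 < r"
    and vol: "ennreal (unit_ball_vol d * r ^ CARD('n) / 2) \<le> emeasure lebesgue {y. g y \<le> t}"
    and h: "continuous_on UNIV h" "\<And>y. h y \<le> g y" "\<And>y. g y \<le> t \<Longrightarrow> g y - t \<le> h y"
  obtains \<xi> N where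
    "norm \<xi> \<le> \<epsilon> * D" "g \<xi> \<le> t" "continuous_on UNIV N" "\<And>y. 0 \<le> N y"
    "\<And>\<sigma>. 0 < \<sigma> \<Longrightarrow> emeasure lebesgue {y. N y < \<sigma>} = emeasure lebesgue (ball (0::real^'n) \<sigma>)"
    "\<And>p y. \<lbrakk>\<And>z. h \<xi> + p \<bullet> (z - \<xi>) \<le> h z\<rbrakk> \<Longrightarrow> \<bar>p \<bullet> y\<bar> \<le> 8 * d / \<eta> * max t (g y)"
    "\<And>p y. \<lbrakk>\<And>z. h \<xi> + p \<bullet> (z - \<xi>) \<le> h z; N y < \<eta> / (4 * (d + 1)) * r\<rbrakk> \<Longrightarrow>
       h y - h \<xi> - p \<bullet> (y - \<xi>) \<le> 32 * (d + 1)\<^sup>2 / \<eta>\<^sup>2 * t * (N y / r)\<^sup>2"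
proof -
  have d: "1 \<le> d" by (simp add: d_def Suc_leI)
  have \<eta>d: "2 * \<eta> * d = \<epsilon>" and \<eta>: "0 < \<eta>" using \<epsilon> d by (auto simp: \<eta>_def d_def[symmetric])
  define S where "S = {y. g y \<le> t}"
  have contg: "continuous_on UNIV g" using g(1) by (intro convex_on_continuous) auto
  have "closed S" unfolding S_def using contg by (intro closed_Collect_le) auto
  moreover have "bounded S" using D unfolding bounded_iff S_def by blast
  ultimately have compS: "compact S" by (simp add: compact_eq_bounded_closed)
  have convg: "g ((1 - v) *\<^sub>R x + v *\<^sub>R y) \<le> (1 - v) * g x + v * g y" if "0 \<le> v" "v \<le> 1" for x y v
    using convex_onD[OF g(1)] that by auto
  have star: "g (v *\<^sub>R y) \<le> v * g y" if "0 \<le> v" "v \<le> 1" for v y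
    using convg[OF that, of 0 y] g(3) by simp
  have convS: "convex S"
  proof (rule convexI)
    fix x y u v :: real assume "0 \<le> u" "0 \<le> v" "u + v = 1"
    show "u *\<^sub>R x + v *\<^sub>R y \<in> S" if "x \<in> S" "y \<in> S" for x y
    proof -
      have u: "u = 1 - v" using \<open>u + v = 1\<close> by simp
      have "g (u *\<^sub>R x + v *\<^sub>R y) \<le> u * g x + v * g y"
        using convg[of v x y] \<open>0 \<le> v\<close> \<open>0 \<le> u\<close> by (simp add: u)
      also have "\<dots> \<le> u * t + v * t"
        using that \<open>0 \<le> v\<close> \<open>0 \<le> u\<close> by (intro add_mono mult_left_mono) (auto simp: S_def)
      also have "\<dots> = t" by (simp add: u algebra_simps)
      finally show ?thesis by (simp add: S_def)
    qed
  qed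
  have "open {y. g y < t}" using contg by (intro open_Collect_less) auto
  then obtain e where e: "0 < e" "cball 0 e \<subseteq> {y. g y < t}"
    using t g(3) by (force simp: open_contains_cball)
  then have eS: "cball 0 e \<subseteq> S" by (auto simp: S_def)
  obtain T Ti :: "real^'n \<Rightarrow> real^'n" where T: "linear T" "linear Ti" "\<And>x. T (Ti x) = x" "\<And>x. Ti (T x) = x"
    and TS: "\<And>i. T (axis i 1) \<in> S" and TiS: "\<And>z i. z \<in> S \<Longrightarrow> \<bar>Ti z $ i\<bar> \<le> 1"
    using maximal_basis_in_compact_set[OF compS e(1) eS] by blast
  have contT: "continuous_on UNIV T" "continuous_on UNIV Ti"
    using T linear_continuous_on linear_linear by blast+
  have Texp: "T \<zeta> = (\<Sum>i\<in>UNIV. \<zeta> $ i *\<^sub>R T (axis i 1))" for \<zeta>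
  proof -
    have "T (\<Sum>i\<in>UNIV. \<zeta> $ i *\<^sub>R axis i 1) = (\<Sum>i\<in>UNIV. \<zeta> $ i *\<^sub>R T (axis i 1))"
      using T(1) by (simp add: linear_sum linear_scale)
    moreover have "(\<Sum>i\<in>UNIV. \<zeta> $ i *\<^sub>R axis i 1) = \<zeta>"
      using basis_expansion[of \<zeta>] by (simp add: scalar_mult_eq_scaleR)
    ultimately show ?thesis by simp
  qed
  \<comment> \<open>Images of this corner simplex are convex combinations of vectors of
    \<open>S\<close>, multiplied by a factor \<open>\<sigma> \<le> \<epsilon>\<close>. Hence they
    stay in \<open>S\<close> and within \<open>\<epsilon> * D\<close> of the origin.\<close>
  have simplex: "T \<zeta> \<in> S" "norm (T \<zeta>) \<le> \<epsilon> * D"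
    if \<zeta>: "\<And>i. 0 \<le> \<zeta> $ i" "(\<Sum>i\<in>UNIV. \<zeta> $ i) \<le> \<epsilon>" for \<zeta>
  proof -
    have D0: "0 \<le> D" using D[of 0] g(3) t by simp
    define \<sigma> where "\<sigma> = (\<Sum>i\<in>UNIV. \<zeta> $ i)"
    have \<sigma>: "0 \<le> \<sigma>" "\<sigma> \<le> 1" using \<zeta> \<epsilon> by (auto simp: \<sigma>_def intro: sum_nonneg)
    show "T \<zeta> \<in> S"
    proof (cases "\<sigma> = 0")
      case True
      then have "\<zeta> $ i = 0" for i using \<zeta> by (simp add: \<sigma>_def sum_nonneg_eq_0_iff)
      then have "T \<zeta> = 0" by (subst Texp) simp
      then show ?thesis using g(3) t by (simp add: S_def)
    next
      case False
      have "(\<Sum>i\<in>UNIV. (\<zeta> $ i / \<sigma>) *\<^sub>R T (axis i 1)) \<in> S"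
        using convS TS \<zeta> \<sigma> False
        by (intro convex_sum) (auto simp: sum_divide_distrib[symmetric] \<sigma>_def)
      then have "g (\<sigma> *\<^sub>R (\<Sum>i\<in>UNIV. (\<zeta> $ i / \<sigma>) *\<^sub>R T (axis i 1))) \<le> \<sigma> * t"
        using star[OF \<sigma>] \<sigma> by (intro order_trans[OF star[OF \<sigma>]] mult_left_mono) (auto simp: S_def)
      also have "\<sigma> * t \<le> t" using \<sigma> t by simp
      also have "\<sigma> *\<^sub>R (\<Sum>i\<in>UNIV. (\<zeta> $ i / \<sigma>) *\<^sub>R T (axis i 1)) = T \<zeta>"
        using False by (subst Texp) (simp add: scaleR_sum_right)
      finally show ?thesis by (simp add: S_def)
    qed
    have "norm (T \<zeta>) \<le> (\<Sum>i\<in>UNIV. norm (\<zeta> $ i *\<^sub>R T (axis i 1)))"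
      by (subst Texp) (rule norm_sum)
    also have "\<dots> \<le> (\<Sum>i\<in>UNIV. \<zeta> $ i * D)"
      using \<zeta> TS D by (intro sum_mono) (auto simp: S_def intro!: mult_left_mono)
    also have "\<dots> = \<sigma> * D" by (simp add: \<sigma>_def sum_distrib_right)
    also have "\<dots> \<le> \<epsilon> * D" using \<zeta> D0 by (intro mult_right_mono) (auto simp: \<sigma>_def)
    finally show "norm (T \<zeta>) \<le> \<epsilon> * D" .
  qed
  \<comment> \<open>In the ball of radius \<open>\<eta>\<close> about \<open>a\<close> all
    coordinates lie between 0 and \<open>2 * \<eta>\<close>, and
    \<open>2 * \<eta> * d = \<epsilon>\<close>, so the ball lies in the corner simplex.\<close>
  define a :: "real^'n" where "a = (\<chi> i. \<eta>)"
  have ball: "T \<zeta> \<in> S" "norm (T \<zeta>) \<le> \<epsilon> * D" if "\<zeta> \<in> cball a \<eta>" for \<zeta>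
  proof -
    have "\<bar>\<zeta> $ i - \<eta>\<bar> \<le> \<eta>" for i
      using component_le_norm_cart[of "\<zeta> - a" i] that by (simp add: a_def dist_norm norm_minus_commute)
    then have i: "0 \<le> \<zeta> $ i \<and> \<zeta> $ i \<le> 2 * \<eta>" for i by (smt (verit))
    then have "(\<Sum>i\<in>UNIV. \<zeta> $ i) \<le> (\<Sum>i\<in>(UNIV::'n set). 2 * \<eta>)" by (intro sum_mono) auto
    also have "\<dots> = \<epsilon>" using \<eta>d by (simp add: d_def mult_ac)
    finally show "T \<zeta> \<in> S" "norm (T \<zeta>) \<le> \<epsilon> * D" using simplex i by auto
  qed
  \<comment> \<open>On the section \<open>h\<close> lies between \<open>- t\<close> and
    \<open>t\<close>, and \<open>M * (\<eta> / 2)\<^sup>2 = 2 * t\<close>. Moving further than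
    \<open>\<eta> / 2\<close> from the centre therefore costs more than \<open>h\<close> can gain,
    and the maximiser lies in the half ball.\<close>
  define M where "M = 8 * t / \<eta>\<^sup>2"
  have M: "0 \<le> M" using t by (simp add: M_def)
  define F where "F \<zeta> = h (T \<zeta>) - M * (norm (\<zeta> - a))\<^sup>2" for \<zeta>
  have "continuous_on (cball a \<eta>) F"
    unfolding F_def
    by (intro continuous_intros continuous_on_compose2[OF h(1)] continuous_on_subset[OF contT(1)]) auto
  then obtain \<zeta>1 where \<zeta>1: "\<zeta>1 \<in> cball a \<eta>" and Fmax: "\<And>\<zeta>. \<zeta> \<in> cball a \<eta> \<Longrightarrow> F \<zeta> \<le> F \<zeta>1"
    using continuous_attains_sup[of "cball a \<eta>" F] \<eta> by auto
  have half: "norm (\<zeta>1 - a) \<le> \<eta> / 2"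
  proof -
    have "- t \<le> h (T a)" using ball(1)[of a] h(3)[of "T a"] g(2)[of "T a"] \<eta> by (simp add: S_def)
    also have "\<dots> = F a" by (simp add: F_def)
    also have "\<dots> \<le> F \<zeta>1" using Fmax \<eta> by simp
    also have "\<dots> \<le> t - M * (norm (\<zeta>1 - a))\<^sup>2"
      using ball(1)[OF \<zeta>1] h(2)[of "T \<zeta>1"] by (simp add: F_def S_def)
    finally have "8 * t / \<eta>\<^sup>2 * (norm (\<zeta>1 - a))\<^sup>2 \<le> 2 * t" by (simp add: M_def)
    then have "8 * t * (norm (\<zeta>1 - a))\<^sup>2 \<le> 2 * t * \<eta>\<^sup>2" using \<eta> by (simp add: field_simps)
    then have "2 * t * (4 * (norm (\<zeta>1 - a))\<^sup>2) \<le> 2 * t * \<eta>\<^sup>2" by (simp add: algebra_simps)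
    then have "4 * (norm (\<zeta>1 - a))\<^sup>2 \<le> \<eta>\<^sup>2" using t by (subst (asm) mult_le_cancel_left_pos) auto
    moreover have "(\<eta> / 2)\<^sup>2 = \<eta>\<^sup>2 / 4" by (simp add: power_divide)
    ultimately have "(norm (\<zeta>1 - a))\<^sup>2 \<le> (\<eta> / 2)\<^sup>2" by linarith
    then show ?thesis by (rule power2_le_imp_le) (use \<eta> in simp)
  qed
  define \<xi> where "\<xi> = T \<zeta>1"
  \<comment> \<open>Maximality at \<open>\<zeta>1\<close>, with the square expanded there; the
    remaining margin \<open>\<eta> / 2\<close> keeps \<open>\<zeta>1 + \<zeta>\<close> in the
    ball.\<close>
  have upper: "h (T (\<zeta>1 + \<zeta>)) - h \<xi> \<le> (2 * M) *\<^sub>R (\<zeta>1 - a) \<bullet> \<zeta> + M * (norm \<zeta>)\<^sup>2"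
    if "norm \<zeta> \<le> \<eta> / 2" for \<zeta>
  proof -
    have "norm (\<zeta>1 + \<zeta> - a) \<le> norm (\<zeta>1 - a) + norm \<zeta>"
      using norm_triangle_ineq[of "\<zeta>1 - a" \<zeta>] by (simp add: algebra_simps)
    then have "\<zeta>1 + \<zeta> \<in> cball a \<eta>" using half that by (simp add: dist_norm norm_minus_commute)
    from Fmax[OF this]
    have "h (T (\<zeta>1 + \<zeta>)) - h \<xi> \<le> M * ((norm (\<zeta>1 + \<zeta> - a))\<^sup>2 - (norm (\<zeta>1 - a))\<^sup>2)"
      by (simp add: F_def \<xi>_def algebra_simps)
    also have "(norm (\<zeta>1 + \<zeta> - a))\<^sup>2 - (norm (\<zeta>1 - a))\<^sup>2 = 2 * ((\<zeta>1 - a) \<bullet> \<zeta>) + (norm \<zeta>)\<^sup>2"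
    proof -
      have "\<zeta>1 + \<zeta> - a = (\<zeta>1 - a) + \<zeta>" by simp
      then show ?thesis by (simp only: power2_norm_eq_inner) (simp add: inner_add_left inner_add_right inner_commute)
    qed
    finally show ?thesis by (simp add: algebra_simps)
  qed
  \<comment> \<open>Pulled back by \<open>T\<close>, a subgradient of \<open>h\<close> at
    \<open>\<xi>\<close> must be the gradient of the paraboloid at \<open>\<zeta>1\<close>.\<close>
  have grad: "adjoint T p = (2 * M) *\<^sub>R (\<zeta>1 - a)" if p: "\<And>z. h \<xi> + p \<bullet> (z - \<xi>) \<le> h z" for p
  proof (rule touching_paraboloid_subgradient)
    show "0 < \<eta> / 2" using \<eta> by simp
    show "adjoint T p \<bullet> \<zeta> \<le> h (T (\<zeta>1 + \<zeta>)) - h \<xi>" for \<zeta>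
    proof -
      have "adjoint T p \<bullet> \<zeta> = p \<bullet> T \<zeta>"
        using adjoint_works[OF T(1), of \<zeta> p] by (simp add: inner_commute)
      also have "\<dots> \<le> h (\<xi> + T \<zeta>) - h \<xi>" using p[of "\<xi> + T \<zeta>"] by simp
      also have "\<xi> + T \<zeta> = T (\<zeta>1 + \<zeta>)" using T(1) by (simp add: \<xi>_def linear_add)
      finally show ?thesis .
    qed
  qed (use upper M in auto)
  have padj: "p \<bullet> y = adjoint T p \<bullet> Ti y" for p y
    using adjoint_works[OF T(1), of "Ti y" p] T(3) by (simp add: inner_commute)
  define G where "G = {y. norm (Ti y) < 1}"
  define m where "m = measure lebesgue G"
  define \<omega> where "\<omega> = unit_ball_vol d"
  have \<omega>: "0 < \<omega>" using d by (simp add: \<omega>_def)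
  have level: "emeasure lebesgue {y. norm (Ti (y - \<xi>)) < c} = ennreal (c ^ CARD('n) * m)"
    if "0 < c" for c \<xi> unfolding m_def G_def by (rule linear_gauge_ball_measure(2)[OF T that])
  \<comment> \<open>On the section all coordinates of \<open>Ti z\<close> are at most 1 in modulus,
    so \<open>norm (Ti z) \<le> d\<close>; taking \<open>d + 1\<close> makes the inequality strict.
    The volume hypothesis then bounds \<open>m\<close> from below.\<close>
  have mvol: "\<omega> * r ^ CARD('n) / 2 \<le> (d + 1) ^ CARD('n) * m"
  proof -
    have "S \<subseteq> {y. norm (Ti (y - 0)) < d + 1}"
    proof
      fix z assume "z \<in> S"
      have "norm (Ti z) \<le> (\<Sum>i\<in>UNIV. \<bar>Ti z $ i\<bar>)" by (rule norm_le_l1_cart)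
      also have "\<dots> \<le> (\<Sum>i\<in>(UNIV::'n set). 1)" using TiS[OF \<open>z \<in> S\<close>] by (intro sum_mono) auto
      also have "\<dots> = d" by (simp add: d_def)
      finally show "z \<in> {y. norm (Ti (y - 0)) < d + 1}" by simp
    qed
    moreover have "{y. norm (Ti (y - 0)) < d + 1} \<in> sets lebesgue"
    proof -
      have "open {y. norm (Ti (y - 0)) < d + 1}"
        by (intro open_Collect_less continuous_intros continuous_on_compose2[OF contT(2)]) auto
      then show ?thesis by auto
    qed
    ultimately have "emeasure lebesgue S \<le> emeasure lebesgue {y. norm (Ti (y - 0)) < d + 1}"
      by (rule emeasure_mono)
    also have "\<dots> = ennreal ((d + 1) ^ CARD('n) * m)" using d by (intro level) simp
    finally have "ennreal (\<omega> * r ^ CARD('n) / 2) \<le> ennreal ((d + 1) ^ CARD('n) * m)"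
      using vol unfolding S_def[symmetric] \<omega>_def[symmetric] by (rule order_trans[rotated])
    then show ?thesis using d by (subst (asm) ennreal_le_iff) (auto simp: m_def)
  qed
  have m: "0 < m"
  proof -
    have "0 < \<omega> * r ^ CARD('n) / 2" using \<omega> r by simp
    then have "0 < (d + 1) ^ CARD('n) * m" using mvol by linarith
    then show ?thesis using d by (simp add: zero_less_mult_iff)
  qed
  \<comment> \<open>With this factor \<open>{y. N y < \<sigma>}\<close> has the volume of the ball
    of radius \<open>\<sigma>\<close>.\<close>
  define q where "q = root CARD('n) (\<omega> / m)"
  have qpow: "q ^ CARD('n) = \<omega> / m" and q: "0 < q"
    using \<omega> m by (auto simp: q_def real_root_pow_pos2)
  \<comment> \<open>The lower bound on \<open>m\<close> in another form. It bounds normalised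
    distances by a fixed multiple of \<open>N y / r\<close>, as
    \<open>q * N y = (q * r) * (N y / r)\<close>.\<close>
  have qr: "q * r \<le> 2 * (d + 1)"
  proof (rule power_le_imp_le_base)
    have "(q * r) ^ Suc (CARD('n) - 1) = (\<omega> * r ^ CARD('n)) / m" by (simp add: power_mult_distrib qpow)
    also have "\<dots> \<le> 2 * (d + 1) ^ CARD('n)" using mvol m by (simp add: field_simps)
    also have "\<dots> \<le> 2 ^ CARD('n) * (d + 1) ^ CARD('n)"
      using d by (intro mult_right_mono self_le_power) auto
    also have "\<dots> = (2 * (d + 1)) ^ Suc (CARD('n) - 1)" by (simp add: power_mult_distrib[symmetric])
    finally show "(q * r) ^ Suc (CARD('n) - 1) \<le> (2 * (d + 1)) ^ Suc (CARD('n) - 1)" .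
  qed (use d in auto)
  define N where "N y = norm (Ti (y - \<xi>)) / q" for y
  show thesis
  proof (rule that[of \<xi> N])
    show "norm \<xi> \<le> \<epsilon> * D" "g \<xi> \<le> t" using ball[OF \<zeta>1] by (auto simp: \<xi>_def S_def)
    show "continuous_on UNIV N"
      unfolding N_def using q by (intro continuous_intros continuous_on_compose2[OF contT(2)]) auto
    show "0 \<le> N y" for y using q by (simp add: N_def)
    show "emeasure lebesgue {y. N y < \<sigma>} = emeasure lebesgue (ball (0::real^'n) \<sigma>)" if "0 < \<sigma>" for \<sigma>
    proof -
      have "{y. N y < \<sigma>} = {y. norm (Ti (y - \<xi>)) < q * \<sigma>}" using q by (auto simp: N_def field_simps)
      moreover have "(q * \<sigma>) ^ CARD('n) * m = unit_ball_vol d * \<sigma> ^ CARD('n)"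
        using m by (simp add: power_mult_distrib qpow \<omega>_def)
      ultimately show ?thesis
        using level[of "q * \<sigma>" \<xi>] q that emeasure_lebesgue_ball[of \<sigma>, where 'n='n] by (simp add: d_def)
    qed
  next
    fix p y assume p: "\<And>z. h \<xi> + p \<bullet> (z - \<xi>) \<le> h z"
    have P: "norm (adjoint T p) \<le> 8 * t / \<eta>"
    proof -
      have "norm (adjoint T p) = 2 * M * norm (\<zeta>1 - a)" using M by (simp add: grad[OF p])
      also have "\<dots> \<le> 2 * M * (\<eta> / 2)" using M half by (intro mult_left_mono) auto
      also have "\<dots> = 8 * t / \<eta>" using \<eta> by (simp add: M_def power2_eq_square)
      finally show ?thesis .
    qed
    have inS: "\<bar>p \<bullet> z\<bar> \<le> 8 * d / \<eta> * t" if "z \<in> S" for z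
    proof -
      have "p \<bullet> z = (\<Sum>i\<in>UNIV. adjoint T p $ i * Ti z $ i)"
        by (subst padj) (simp add: inner_vec_def)
      then have "\<bar>p \<bullet> z\<bar> \<le> (\<Sum>i\<in>UNIV. \<bar>adjoint T p $ i * Ti z $ i\<bar>)"
        using sum_abs by metis
      also have "\<dots> \<le> (\<Sum>i\<in>(UNIV::'n set). 8 * t / \<eta> * 1)"
        unfolding abs_mult
        using TiS[OF that] order_trans[OF component_le_norm_cart P] t \<eta>
        by (intro sum_mono mult_mono) auto
      also have "\<dots> = 8 * d / \<eta> * t" by (simp add: d_def)
      finally show ?thesis .
    qed
    show "\<bar>p \<bullet> y\<bar> \<le> 8 * d / \<eta> * max t (g y)"
    proof (cases "g y \<le> t")
      case True
      then show ?thesis using inS[of y] by (simp add: S_def max_def)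
    next
      case False
      \<comment> \<open>The point is pulled back along its ray into the section, where the bound is
        known; convexity with \<open>g 0 = 0\<close> gives
        \<open>g (v *\<^sub>R y) \<le> t\<close>.\<close>
      define v where "v = t / g y"
      have v: "0 < v" "v \<le> 1" using False t by (auto simp: v_def)
      have "g (v *\<^sub>R y) \<le> t" using star[of v y] v False t by (simp add: v_def)
      then have "\<bar>p \<bullet> (v *\<^sub>R y)\<bar> \<le> 8 * d / \<eta> * t" by (intro inS) (simp add: S_def)
      then have "v * \<bar>p \<bullet> y\<bar> \<le> 8 * d / \<eta> * t" using v by (simp add: abs_mult)
      also have "8 * d / \<eta> * t = v * (8 * d / \<eta> * g y)" using False t by (simp add: v_def)
      finally have "\<bar>p \<bullet> y\<bar> \<le> 8 * d / \<eta> * g y" using v(1) by (rule mult_left_le_imp_le)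
      then show ?thesis using False by simp
    qed
    assume Ny: "N y < \<eta> / (4 * (d + 1)) * r"
    define \<zeta> where "\<zeta> = Ti (y - \<xi>)"
    have n\<zeta>: "norm \<zeta> = q * N y" using q by (simp add: N_def \<zeta>_def)
    \<comment> \<open>The threshold on \<open>N y\<close> is chosen so that
      \<open>norm \<zeta> \<le> \<eta> / 2\<close>, the range in which \<open>upper\<close>
      holds.\<close>
    have "q * N y \<le> q * (\<eta> / (4 * (d + 1)) * r)" using Ny q by (intro mult_left_mono) auto
    also have "\<dots> = (q * r) * (\<eta> / (4 * (d + 1)))" by simp
    also have "\<dots> \<le> (2 * (d + 1)) * (\<eta> / (4 * (d + 1)))" using qr \<eta> d by (intro mult_right_mono) auto
    also have "\<dots> = \<eta> / 2" using d by (simp add: field_simps)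
    finally have small: "norm \<zeta> \<le> \<eta> / 2" using n\<zeta> by simp
    have yT: "T (\<zeta>1 + \<zeta>) = y" using T(1,3) by (simp add: \<zeta>_def \<xi>_def linear_add)
    have "h y - h \<xi> - p \<bullet> (y - \<xi>) \<le> M * (norm \<zeta>)\<^sup>2"
    proof -
      have "p \<bullet> (y - \<xi>) = (2 * M) *\<^sub>R (\<zeta>1 - a) \<bullet> \<zeta>"
        using padj[of p "y - \<xi>"] unfolding grad[OF p] \<zeta>_def .
      moreover have "h y - h \<xi> \<le> (2 * M) *\<^sub>R (\<zeta>1 - a) \<bullet> \<zeta> + M * (norm \<zeta>)\<^sup>2"
        using upper[OF small] unfolding yT .
      ultimately show ?thesis by linarith
    qed
    also have "\<dots> = 8 * t / \<eta>\<^sup>2 * (q * r)\<^sup>2 * (N y / r)\<^sup>2"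
      using r by (simp add: n\<zeta> M_def power_mult_distrib power_divide)
    also have "\<dots> \<le> 8 * t / \<eta>\<^sup>2 * (2 * (d + 1))\<^sup>2 * (N y / r)\<^sup>2"
      using qr q r t by (intro mult_right_mono mult_left_mono power_mono) auto
    also have "\<dots> = 32 * (d + 1)\<^sup>2 / \<eta>\<^sup>2 * t * (N y / r)\<^sup>2"
    proof -
      have "(2 * (d + 1))\<^sup>2 = 4 * (d + 1)\<^sup>2" by (simp add: power2_eq_square algebra_simps)
      then show ?thesis by (simp only:) simp
    qed
    finally show "h y - h \<xi> - p \<bullet> (y - \<xi>) \<le> 32 * (d + 1)\<^sup>2 / \<eta>\<^sup>2 * t * (N y / r)\<^sup>2" .
  qed
qed

section \<open>Testing with the glued kernel\<close>

lemma admissible_kernel_level: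
  fixes K :: "real^'n \<Rightarrow> ennreal"
  assumes "admissible_kernel s K" "0 < r"
  shows "emeasure lebesgue {y. ennreal (r powr (- real CARD('n) - s)) < K y} =
    ennreal (unit_ball_vol (real CARD('n)) * r ^ CARD('n))"
proof -
  have "emeasure lebesgue {y. ennreal (r powr (- real CARD('n) - s)) < K y} =
      emeasure lebesgue (ball (0::real^'n) r)"
    using assms unfolding admissible_kernel_def by blast
  also have "\<dots> = ennreal (unit_ball_vol (real CARD('n)) * r ^ CARD('n))"
    using assms(2) by (intro emeasure_lebesgue_ball) simp
  finally show ?thesis .
qed

text \<open>The set where \<open>K\<close> is infinite lies in every superlevel set, and these have
  the volumes of balls of arbitrarily small radius.\<close>

lemma admissible_kernel_finite_AE:
  fixes K :: "real^'n \<Rightarrow> ennreal"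
  assumes K: "admissible_kernel s K"
  shows "AE y in lebesgue. K y < top"
proof -
  note [measurable] = admissible_kernel_measurable[OF K]
  define Z where "Z = {y. K y = top}"
  have Z[measurable]: "Z \<in> sets lebesgue"
  proof -
    have "{y \<in> space lebesgue. K y = top} \<in> sets lebesgue" by measurable
    then show ?thesis by (simp add: Z_def)
  qed
  have le: "emeasure lebesgue Z \<le> ennreal (unit_ball_vol (real CARD('n)) * r ^ CARD('n))" if "0 < r" for r
  proof -
    have "emeasure lebesgue Z \<le> emeasure lebesgue {y. ennreal c < K y}" for c
      by (intro emeasure_mono sets_lebesgue_Collect_less) (auto simp: Z_def)
    then show ?thesis by (metis admissible_kernel_level[OF K that])
  qed
  have "emeasure lebesgue Z \<le> 0"
  proof (rule LIMSEQ_le_const)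
    show "(\<lambda>k. ennreal (unit_ball_vol (real CARD('n)) * (inverse (real (Suc k))) ^ CARD('n))) \<longlonglongrightarrow> 0"
      using tendsto_ennrealI[OF tendsto_mult[OF tendsto_const tendsto_power[OF LIMSEQ_inverse_real_of_nat, of "CARD('n)"],
            of "unit_ball_vol (real CARD('n))"]]
      by (simp add: zero_power)
  qed (use le in auto)
  then have "Z \<in> null_sets lebesgue" using Z by (simp add: null_sets_def)
  then show ?thesis
    by (rule AE_I') (auto simp: Z_def not_less top.extremum_unique)
qed

text \<open>The integral of \<open>g K\<close> over the superlevel set \<open>E r\<close> tends to 0
  with \<open>r\<close>. By Chebyshev's inequality with \<open>t = \<delta> * r powr s\<close>, the
  bound \<open>g y \<le> t\<close> fails on at most half of the volume of \<open>E r\<close>; the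
  other half lies in the section.\<close>

lemma exists_flat_section:
  fixes K :: "real^'n \<Rightarrow> ennreal" and g :: "real^'n \<Rightarrow> real"
  assumes K: "admissible_kernel s K" and s: "0 < s"
    and g: "continuous_on UNIV g" "\<And>y. 0 \<le> g y"
    and fin: "(\<integral>\<^sup>+y. ennreal (g y) * K y \<partial>lebesgue) < \<infinity>" and \<delta>: "0 < \<delta>"
  obtains r t where "0 < r" "0 < t" "t \<le> \<delta>" "t * r powr (- s) \<le> \<delta>"
    "ennreal (unit_ball_vol (real CARD('n)) * r ^ CARD('n) / 2) \<le> emeasure lebesgue {y. g y \<le> t}"
proof -
  define d where "d = real CARD('n)"
  define \<omega> where "\<omega> = unit_ball_vol d"
  have \<omega>: "0 < \<omega>" by (simp add: \<omega>_def d_def)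
  note Km[measurable] = admissible_kernel_measurable[OF K]
  have gm[measurable]: "g \<in> borel_measurable lebesgue"
    using g(1) by (rule borel_measurable_lebesgue_continuous)
  define \<rho> where "\<rho> k = inverse (real (Suc k))" for k
  have \<rho>: "0 < \<rho> k" "\<rho> k \<le> 1" for k by (auto simp: \<rho>_def field_simps)
  have \<rho>0: "\<rho> \<longlonglongrightarrow> 0" unfolding \<rho>_def by (rule LIMSEQ_inverse_real_of_nat)
  define E where "E r = {y. ennreal (r powr (- d - s)) < K y}" for r
  have E[measurable]: "E r \<in> sets lebesgue" for r
    unfolding E_def by (intro sets_lebesgue_Collect_less) auto
  have "(\<lambda>k. \<integral>\<^sup>+y. ennreal (g y) * K y * indicator (E (\<rho> k)) y \<partial>lebesgue) \<longlonglongrightarrow> integral\<^sup>N lebesgue (\<lambda>y::real^'n. 0)"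
  proof (rule nn_integral_dominated_convergence[where w="\<lambda>y. ennreal (g y) * K y"])
    show "AE y in lebesgue. (\<lambda>k. ennreal (g y) * K y * indicator (E (\<rho> k)) y) \<longlonglongrightarrow> 0"
      using admissible_kernel_finite_AE[OF K]
    proof eventually_elim
      case (elim y)
      then obtain c where c: "0 \<le> c" "K y = ennreal c" by (cases "K y") auto
      have "\<forall>\<^sub>F k in sequentially. c \<le> \<rho> k powr (- d - s)"
        using eventually_ge_at_top[of "nat \<lceil>c\<rceil>"]
      proof eventually_elim
        case (elim k)
        have d1: "1 \<le> d" by (simp add: d_def Suc_leI)
        have "c \<le> real (Suc k)" using elim by linarith
        also have "\<dots> = real (Suc k) powr 1" by simp
        also have "\<dots> \<le> real (Suc k) powr (d + s)" using d1 s by (intro powr_mono) auto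
        also have "\<dots> = \<rho> k powr (- (d + s))" unfolding \<rho>_def powr_minus by (subst inverse_powr) auto
        finally show ?case by simp
      qed
      then have "\<forall>\<^sub>F k in sequentially. ennreal (g y) * K y * indicator (E (\<rho> k)) y = 0"
        by eventually_elim (simp add: E_def c not_less ennreal_leI)
      then show ?case by (rule tendsto_eventually)
    qed
  qed (use fin in \<open>auto simp: indicator_def\<close>)
  then have lim: "(\<lambda>k. \<integral>\<^sup>+y. ennreal (g y) * K y * indicator (E (\<rho> k)) y \<partial>lebesgue) \<longlonglongrightarrow> 0" by simp
  \<comment> \<open>This threshold equals the Chebyshev level \<open>t * r powr (- d - s)\<close>
    times half the volume of the ball of radius \<open>r\<close>.\<close>
  have "0 < ennreal (\<omega> * \<delta> / 2)" using \<omega> \<delta> by simp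
  then have "\<forall>\<^sub>F k in sequentially. (\<integral>\<^sup>+y. ennreal (g y) * K y * indicator (E (\<rho> k)) y \<partial>lebesgue) < ennreal (\<omega> * \<delta> / 2)"
    using lim by (intro order_tendstoD)
  then obtain k where k: "(\<integral>\<^sup>+y. ennreal (g y) * K y * indicator (E (\<rho> k)) y \<partial>lebesgue) < ennreal (\<omega> * \<delta> / 2)"
    by (auto simp: eventually_sequentially)
  define r where "r = \<rho> k"
  have r: "0 < r" "r \<le> 1" using \<rho> by (auto simp: r_def)
  define t where "t = \<delta> * r powr s"
  have t: "0 < t" using \<delta> r by (simp add: t_def)
  have t\<delta>: "t \<le> \<delta>" using \<delta> r s by (simp add: t_def powr_le1)
  have tr: "t * r powr (- s) \<le> \<delta>" using r by (simp add: t_def powr_minus field_simps)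
  define W where "W = E r \<inter> {y. t < g y}"
  have W[measurable]: "W \<in> sets lebesgue"
    unfolding W_def by (intro sets.Int E sets_lebesgue_Collect_less) auto
  have gs[measurable]: "{y. g y \<le> t} \<in> sets lebesgue"
  proof -
    have "{y \<in> space lebesgue. g y \<le> t} \<in> sets lebesgue" by measurable
    then show ?thesis by simp
  qed
  have Wle: "emeasure lebesgue W \<le> ennreal (\<omega> * r ^ CARD('n) / 2)"
  proof -
    have c: "0 < t * r powr (- d - s)" using t r by simp
    have "ennreal (t * r powr (- d - s)) * emeasure lebesgue W
        = (\<integral>\<^sup>+y. ennreal (t * r powr (- d - s)) * indicator W y \<partial>lebesgue)"
      by (rule nn_integral_cmult_indicator[symmetric]) (rule W)
    also have "\<dots> \<le> (\<integral>\<^sup>+y. ennreal (g y) * K y * indicator (E r) y \<partial>lebesgue)"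
    proof (rule nn_integral_mono)
      fix y
      show "ennreal (t * r powr (- d - s)) * indicator W y \<le> ennreal (g y) * K y * indicator (E r) y"
      proof (cases "y \<in> W")
        case True
        then have "ennreal t * ennreal (r powr (- d - s)) \<le> ennreal (g y) * K y"
          by (intro mult_mono) (auto simp: W_def E_def intro: ennreal_leI)
        then show ?thesis using True t by (simp add: W_def ennreal_mult)
      qed simp
    qed
    also have "\<dots> \<le> ennreal (\<omega> * \<delta> / 2)" using k by (simp add: r_def)
    also have "\<omega> * \<delta> / 2 = (t * r powr (- d - s)) * (\<omega> * r ^ CARD('n) / 2)"
    proof -
      have "r powr s * r powr (- d - s) * r powr d = 1"
        using r by (simp add: powr_add[symmetric])
      moreover have "r ^ CARD('n) = r powr d" using r by (simp add: d_def powr_realpow)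
      ultimately show ?thesis by (simp add: t_def mult_ac)
    qed
    also have "ennreal \<dots> = ennreal (t * r powr (- d - s)) * ennreal (\<omega> * r ^ CARD('n) / 2)"
      using c \<omega> r by (intro ennreal_mult) auto
    finally show ?thesis
      using c by (subst (asm) ennreal_mult_le_mult_iff) auto
  qed
  have "ennreal (\<omega> * r ^ CARD('n)) = emeasure lebesgue (E r)"
    unfolding E_def \<omega>_def d_def by (rule admissible_kernel_level[OF K r(1), symmetric])
  also have "\<dots> \<le> emeasure lebesgue (W \<union> {y. g y \<le> t})"
    by (intro emeasure_mono) (auto simp: W_def)
  also have "\<dots> \<le> emeasure lebesgue W + emeasure lebesgue {y. g y \<le> t}"
    by (intro emeasure_subadditive) auto
  also have "\<dots> \<le> ennreal (\<omega> * r ^ CARD('n) / 2) + emeasure lebesgue {y. g y \<le> t}"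
    using Wle by (intro add_right_mono)
  also have "ennreal (\<omega> * r ^ CARD('n)) = ennreal (\<omega> * r ^ CARD('n) / 2) + ennreal (\<omega> * r ^ CARD('n) / 2)"
    using \<omega> r by (subst ennreal_plus[symmetric]) auto
  finally have "ennreal (\<omega> * r ^ CARD('n) / 2) \<le> emeasure lebesgue {y. g y \<le> t}"
    by (subst (asm) ennreal_add_left_cancel_le) auto
  then show thesis using r(1) t t\<delta> tr unfolding \<omega>_def d_def by (intro that[of r t])
qed

text \<open>Compactness: slopes violating the claim for \<open>\<tau>\<close> tending to 0 would be
  bounded and have a limit of norm at least \<open>\<sigma>\<close> that obeys the bound with
  \<open>\<tau> = 0\<close>, contrary to \<open>ext\<close>.\<close>

lemma subgradient_deviation_small:
  fixes g :: "'a::euclidean_space \<Rightarrow> real"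
  assumes g: "continuous_on UNIV g" "\<And>y. 0 \<le> g y"
    and ext: "\<And>p. (\<And>y. \<bar>p \<bullet> y\<bar> \<le> C * g y) \<Longrightarrow> p = 0"
    and C: "0 < C" and \<sigma>: "0 < \<sigma>"
  obtains \<tau> where "0 < \<tau>" "\<And>p. (\<And>y. \<bar>p \<bullet> y\<bar> \<le> C * max \<tau> (g y)) \<Longrightarrow> norm p \<le> \<sigma>"
proof (rule ccontr)
  assume neg: "\<not> thesis"
  define \<tau> where "\<tau> k = inverse (real (Suc k))" for k
  have \<tau>: "0 < \<tau> k" "\<tau> k \<le> 1" for k by (auto simp: \<tau>_def field_simps)
  have \<tau>0: "\<tau> \<longlonglongrightarrow> 0" unfolding \<tau>_def by (rule LIMSEQ_inverse_real_of_nat)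
  have "\<exists>p. (\<forall>y. \<bar>p \<bullet> y\<bar> \<le> C * max (\<tau> k) (g y)) \<and> \<sigma> < norm p" for k
    using neg that[OF \<tau>(1)[of k]] not_le by blast
  then obtain p where p: "\<And>k y. \<bar>p k \<bullet> y\<bar> \<le> C * max (\<tau> k) (g y)" and np: "\<And>k. \<sigma> < norm (p k)" by metis
  have "\<exists>x\<in>cball 0 1. \<forall>y\<in>cball 0 1. g y \<le> g x"
    using continuous_on_subset[OF g(1)] by (intro continuous_attains_sup) auto
  then obtain y0 where y0: "\<And>y. norm y \<le> 1 \<Longrightarrow> g y \<le> g y0" by (metis mem_cball_0)
  \<comment> \<open>Testing with the unit vector in the direction of \<open>p k\<close> controls its
    norm by the maximum of \<open>g\<close> on the unit ball.\<close>
  have bnd: "norm (p k) \<le> C * max 1 (g y0)" for k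
  proof -
    have "p k \<noteq> 0" using np[of k] \<sigma> by auto
    define y where "y = inverse (norm (p k)) *\<^sub>R p k"
    have "norm y \<le> 1" using \<open>p k \<noteq> 0\<close> by (simp add: y_def)
    have "p k \<bullet> y = norm (p k)"
      using \<open>p k \<noteq> 0\<close> by (simp add: y_def dot_square_norm power2_eq_square)
    then have "norm (p k) \<le> C * max (\<tau> k) (g y)" using p[of k y] by simp
    also have "\<dots> \<le> C * max 1 (g y0)"
      using C \<tau>(2)[of k] y0[OF \<open>norm y \<le> 1\<close>] by (intro mult_left_mono max.mono) auto
    finally show ?thesis .
  qed
  have "compact (cball (0::'a) (C * max 1 (g y0)))" by simp
  then obtain l \<phi> where l: "strict_mono \<phi>" "(p \<circ> \<phi>) \<longlonglongrightarrow> l"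
    using bnd unfolding compact_def by (metis mem_cball_0)
  have "\<bar>l \<bullet> y\<bar> \<le> C * max 0 (g y)" for y
  proof (rule LIMSEQ_le)
    show "(\<lambda>k. \<bar>(p \<circ> \<phi>) k \<bullet> y\<bar>) \<longlonglongrightarrow> \<bar>l \<bullet> y\<bar>" by (intro tendsto_intros l)
    have "(\<lambda>k. \<tau> (\<phi> k)) \<longlonglongrightarrow> 0" using LIMSEQ_subseq_LIMSEQ[OF \<tau>0 l(1)] by (simp add: o_def)
    then show "(\<lambda>k. C * max (\<tau> (\<phi> k)) (g y)) \<longlonglongrightarrow> C * max 0 (g y)" by (intro tendsto_intros)
  qed (use p in auto)
  then have "l = 0" using ext[of l] g(2) by (simp add: max_def)
  moreover have "\<sigma> \<le> norm l"
    by (rule LIMSEQ_le_const[OF tendsto_norm[OF l(2)]]) (use np in \<open>auto intro: less_imp_le\<close>)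
  ultimately show False using \<sigma> by simp
qed

text \<open>Dominated convergence as \<open>\<sigma>\<close> tends to 0. The cap
  \<open>C * g y\<close> provides the majorant, since \<open>norm y * K y\<close> alone need not be
  integrable; finiteness of \<open>K\<close> almost everywhere gives the pointwise limit.\<close>

lemma truncated_linear_integral_small:
  fixes K :: "real^'n \<Rightarrow> ennreal" and g :: "real^'n \<Rightarrow> real"
  assumes K: "admissible_kernel s K"
    and g: "continuous_on UNIV g" "\<And>y. 0 \<le> g y"
    and fin: "(\<integral>\<^sup>+y. ennreal (g y) * K y \<partial>lebesgue) < \<infinity>" and C: "0 \<le> C" and \<eta>: "0 < \<eta>"
  obtains \<sigma> where "0 < \<sigma>"
    "(\<integral>\<^sup>+y. ennreal (min (\<sigma> * norm y) (C * g y)) * K y \<partial>lebesgue) \<le> ennreal \<eta>"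
proof -
  note Km[measurable] = admissible_kernel_measurable[OF K]
  have gm[measurable]: "g \<in> borel_measurable lebesgue"
    using g(1) by (rule borel_measurable_lebesgue_continuous)
  have nm[measurable]: "(\<lambda>y::real^'n. norm y) \<in> borel_measurable lebesgue"
    by (intro measurable_completion) simp
  define \<sigma> where "\<sigma> k = inverse (real (Suc k))" for k
  have \<sigma>: "0 < \<sigma> k" for k by (auto simp: \<sigma>_def)
  have \<sigma>0: "\<sigma> \<longlonglongrightarrow> 0" unfolding \<sigma>_def by (rule LIMSEQ_inverse_real_of_nat)
  have "(\<lambda>k. \<integral>\<^sup>+y. ennreal (min (\<sigma> k * norm y) (C * g y)) * K y \<partial>lebesgue) \<longlonglongrightarrow> integral\<^sup>N lebesgue (\<lambda>y::real^'n. 0)"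
  proof (rule nn_integral_dominated_convergence[where w="\<lambda>y. ennreal C * (ennreal (g y) * K y)"])
    show "AE y in lebesgue. (\<lambda>k. ennreal (min (\<sigma> k * norm y) (C * g y)) * K y) \<longlonglongrightarrow> 0"
      using admissible_kernel_finite_AE[OF K]
    proof eventually_elim
      case (elim y)
      have "(\<lambda>k. ennreal (min (\<sigma> k * norm y) (C * g y))) \<longlonglongrightarrow> ennreal (min (0 * norm y) (C * g y))"
        by (intro tendsto_ennrealI tendsto_intros \<sigma>0)
      moreover have "min (0 * norm y) (C * g y) = 0" using C g(2)[of y] by simp
      ultimately have "(\<lambda>k. ennreal (min (\<sigma> k * norm y) (C * g y))) \<longlonglongrightarrow> 0" by simp
      then have "(\<lambda>k. K y * ennreal (min (\<sigma> k * norm y) (C * g y))) \<longlonglongrightarrow> K y * 0"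
        using elim by (intro ennreal_tendsto_cmult) auto
      then show ?case by (simp add: mult.commute)
    qed
    show "AE y in lebesgue. ennreal (min (\<sigma> j * norm y) (C * g y)) * K y \<le> ennreal C * (ennreal (g y) * K y)" for j
    proof (intro AE_I2)
      fix y
      have "ennreal (min (\<sigma> j * norm y) (C * g y)) \<le> ennreal C * ennreal (g y)"
        using C g(2)[of y] by (simp add: ennreal_mult[symmetric] ennreal_leI)
      then show "ennreal (min (\<sigma> j * norm y) (C * g y)) * K y \<le> ennreal C * (ennreal (g y) * K y)"
        by (simp add: mult.assoc[symmetric] mult_right_mono)
    qed
    show "(\<integral>\<^sup>+y. ennreal C * (ennreal (g y) * K y) \<partial>lebesgue) < \<infinity>"
      using fin by (subst nn_integral_cmult) (auto simp: ennreal_mult_less_top)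
  qed auto
  then have "(\<lambda>k. \<integral>\<^sup>+y. ennreal (min (\<sigma> k * norm y) (C * g y)) * K y \<partial>lebesgue) \<longlonglongrightarrow> 0" by simp
  then have "\<forall>\<^sub>F k in sequentially. (\<integral>\<^sup>+y. ennreal (min (\<sigma> k * norm y) (C * g y)) * K y \<partial>lebesgue) < ennreal \<eta>"
    using \<eta> by (intro order_tendstoD) auto
  then obtain k where "(\<integral>\<^sup>+y. ennreal (min (\<sigma> k * norm y) (C * g y)) * K y \<partial>lebesgue) < ennreal \<eta>"
    by (auto simp: eventually_sequentially)
  then show thesis using that[OF \<sigma>[of k]] by (simp add: less_imp_le)
qed

text \<open>The case distinction is needed because \<open>0 powr e = 0\<close>.\<close>

lemma gauge_kernel_greater_iff:
  assumes "0 \<le> x" "0 < \<rho>" "e < (0::real)"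
  shows "ennreal (\<rho> powr e) < (if x = 0 then top else ennreal (x powr e)) \<longleftrightarrow> x < \<rho>"
proof (cases "x = 0")
  case False
  then have x: "0 < x" using assms by simp
  have "\<rho> powr e < x powr e \<longleftrightarrow> x < \<rho>"
    using powr_less_mono2_neg[OF assms(3) x, of \<rho>] powr_mono2'[of e \<rho> x] assms x
    by (cases "x < \<rho>") (auto simp: not_less)
  then show ?thesis using False by (simp add: ennreal_less_iff)
qed (use assms in auto)

text \<open>The superlevel sets are the sublevel sets of \<open>N\<close>. This turns the gauge of
  the touching paraboloid into a test kernel.\<close>

lemma gauge_kernel_admissible:
  fixes N :: "real^'n \<Rightarrow> real"
  assumes N: "continuous_on UNIV N" "\<And>y. 0 \<le> N y"
    and lev: "\<And>\<sigma>. 0 < \<sigma> \<Longrightarrow> emeasure lebesgue {y. N y < \<sigma>} = emeasure lebesgue (ball (0::real^'n) \<sigma>)"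
    and s: "0 < s"
  shows "admissible_kernel s (\<lambda>y. if N y = 0 then top else ennreal (N y powr (- real CARD('n) - s)))"
proof -
  define e where "e = - real CARD('n) - s"
  have e: "e < 0" using s by (simp add: e_def)
  have [measurable]: "N \<in> borel_measurable lebesgue"
    using N(1) by (rule borel_measurable_lebesgue_continuous)
  show ?thesis
    unfolding admissible_kernel_def e_def[symmetric]
  proof (intro conjI allI impI)
    show "(\<lambda>y. if N y = 0 then top else ennreal (N y powr e)) \<in> borel_measurable lebesgue" by measurable
    show "emeasure lebesgue {y. ennreal (r powr e) < (if N y = 0 then top else ennreal (N y powr e))} =
        emeasure lebesgue (ball (0::real^'n) r)" if "0 < r" for r
      unfolding gauge_kernel_greater_iff[OF N(2) that e] by (rule lev[OF that])
  qed
qed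

text \<open>The height \<open>t\<close> is fixed before \<open>h\<close>, so that an approximating
  sub-solution of accuracy \<open>t\<close> can be chosen afterwards. The excess over the integral
  of \<open>g K\<close> has three sources: heights of order \<open>t\<close> against the truncated
  kernel, the slope \<open>p\<close>, and the paraboloid at small scales.\<close>

lemma touching_kernel_estimate:
  fixes K :: "real^'n \<Rightarrow> ennreal" and g :: "real^'n \<Rightarrow> real"
  assumes s: "0 < s" "s < 2" and K: "admissible_kernel s K"
    and g: "convex_on UNIV g" "\<And>y. 0 \<le> g y" "g 0 = 0"
    and fin: "(\<integral>\<^sup>+y. ennreal (g y) * K y \<partial>lebesgue) < \<infinity>"
    and ext: "\<forall>p C. 0 < C \<longrightarrow> (\<forall>y. \<bar>p \<bullet> y\<bar> \<le> C * g y) \<longrightarrow> p = 0"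
    and D: "\<forall>y. g y \<le> 1 \<longrightarrow> norm y \<le> D"
    and \<epsilon>: "0 < \<epsilon>" "\<epsilon> \<le> 1" and \<gamma>: "0 < \<gamma>"
  obtains t where "0 < t" "t \<le> \<gamma>"
    "\<And>h. \<lbrakk>continuous_on UNIV h; \<forall>y. h y \<le> g y; \<forall>y. g y \<le> 1 \<longrightarrow> g y - t \<le> h y\<rbrakk> \<Longrightarrow>
      \<exists>\<xi>. norm \<xi> \<le> \<epsilon> * D \<and> (\<forall>p. (\<forall>z. h \<xi> + p \<bullet> (z - \<xi>) \<le> h z) \<longrightarrow>
        (\<exists>K'. admissible_kernel s K' \<and>
          (\<integral>\<^sup>+y. ennreal (h y - h \<xi> - p \<bullet> (y - \<xi>)) * K' y \<partial>lebesgue)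
            \<le> (\<integral>\<^sup>+y. ennreal (g y) * K y \<partial>lebesgue) + ennreal \<gamma>))"
proof -
  define d where "d = real CARD('n)"
  define e where "e = - d - s"
  have d: "1 \<le> d" by (simp add: d_def Suc_leI)
  have e: "e < 0" using d s by (simp add: e_def)
  define \<eta> where "\<eta> = \<epsilon> / (2 * d)"
  have \<eta>: "0 < \<eta>" using \<epsilon> d by (simp add: \<eta>_def)
  define C1 where "C1 = 8 * d / \<eta>"
  define C2 where "C2 = 32 * (d + 1)\<^sup>2 / \<eta>\<^sup>2"
  define \<theta> where "\<theta> = \<eta> / (4 * (d + 1))"
  have C1: "0 < C1" and C2: "0 < C2" and \<theta>: "0 < \<theta>" using \<eta> d by (auto simp: C1_def C2_def \<theta>_def)
  obtain A where A: "0 \<le> A"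
    "\<And>(K::real^'n \<Rightarrow> ennreal) \<rho>. \<lbrakk>admissible_kernel s K; 0 < \<rho>\<rbrakk> \<Longrightarrow>
      (\<integral>\<^sup>+y. min (K y) (ennreal (\<rho> powr e)) \<partial>lebesgue) \<le> ennreal (A * \<rho> powr (- s))"
    unfolding e_def d_def using truncated_kernel_integral_bound[OF s(1), where 'n='n] by blast
  obtain B where B: "0 \<le> B"
    "\<And>(N::real^'n \<Rightarrow> real) \<rho>. \<lbrakk>N \<in> borel_measurable lebesgue; \<And>y. 0 \<le> N y; 0 < \<rho>;
       \<And>\<sigma>. 0 < \<sigma> \<Longrightarrow> emeasure lebesgue {y. N y < \<sigma>} = emeasure lebesgue (ball (0::real^'n) \<sigma>)\<rbrakk> \<Longrightarrow>
      (\<integral>\<^sup>+y. ennreal ((N y)\<^sup>2 * N y powr e) * indicator {y. N y < \<rho>} y \<partial>lebesgue)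
        \<le> ennreal (B * \<rho> powr (2 - s))"
    unfolding e_def d_def using inner_kernel_integral_bound[OF s, where 'n='n] by blast
  have contg: "continuous_on UNIV g" using g(1) by (intro convex_on_continuous) auto
  note Km[measurable] = admissible_kernel_measurable[OF K]
  have gm[measurable]: "g \<in> borel_measurable lebesgue"
    using contg by (rule borel_measurable_lebesgue_continuous)
  have nm[measurable]: "(\<lambda>y::real^'n. norm y) \<in> borel_measurable lebesgue"
    by (intro measurable_completion) simp
  obtain \<sigma> where \<sigma>: "0 < \<sigma>"
    "(\<integral>\<^sup>+y. ennreal (min (\<sigma> * norm y) (C1 * g y)) * K y \<partial>lebesgue) \<le> ennreal (\<gamma> / 4)"
    using truncated_linear_integral_small[OF K contg g(2) fin, of C1 "\<gamma> / 4"] C1 \<gamma> by auto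
  have ext1: "p = 0" if "\<And>y. \<bar>p \<bullet> y\<bar> \<le> C1 * g y" for p
    using ext C1 that by blast
  obtain \<tau> where \<tau>: "0 < \<tau>" "\<And>p. (\<And>y. \<bar>p \<bullet> y\<bar> \<le> C1 * max \<tau> (g y)) \<Longrightarrow> norm p \<le> \<sigma>"
    using subgradient_deviation_small[OF contg g(2) ext1 C1 \<sigma>(1)] by blast
  \<comment> \<open>\<open>X\<close> and \<open>Y\<close> collect the constants in front of
    \<open>t * r powr (- s)\<close> in the height error and in the paraboloid error.\<close>
  define X where "X = (1 + 2 * C1) * A * \<theta> powr (- s)"
  define Y where "Y = C2 * B * \<theta> powr (2 - s)"
  have XY: "0 \<le> X" "0 \<le> Y" using C1 C2 A(1) B(1) by (auto simp: X_def Y_def)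
  \<comment> \<open>The bound by \<open>\<tau>\<close> forces the slope to have norm at most
    \<open>\<sigma>\<close>. The last bound makes the height and paraboloid errors together at most
    \<open>\<gamma> / 4\<close>, which leaves room for the slope error
    \<open>\<gamma> / 4\<close>.\<close>
  define \<delta> where "\<delta> = min (min 1 \<gamma>) (min \<tau> (\<gamma> / (4 * (X + Y + 1))))"
  have \<delta>: "0 < \<delta>" "\<delta> \<le> 1" "\<delta> \<le> \<gamma>" "\<delta> \<le> \<tau>" "\<delta> \<le> \<gamma> / (4 * (X + Y + 1))"
    using \<gamma> \<tau> XY by (auto simp: \<delta>_def)
  have "(X + Y + 1) * \<delta> \<le> (X + Y + 1) * (\<gamma> / (4 * (X + Y + 1)))"
    using \<delta> XY by (intro mult_left_mono) auto
  also have "\<dots> = \<gamma> / 4" using XY by (simp add: field_simps)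
  finally have XY\<delta>: "X * \<delta> + Y * \<delta> \<le> \<gamma> / 4" using \<delta>(1) by (simp add: algebra_simps)
  obtain r t where r: "0 < r" and t: "0 < t" "t \<le> \<delta>" "t * r powr (- s) \<le> \<delta>"
    and vol: "ennreal (unit_ball_vol d * r ^ CARD('n) / 2) \<le> emeasure lebesgue {y. g y \<le> t}"
    unfolding d_def using exists_flat_section[OF K s(1) contg g(2) fin \<delta>(1)] by blast
  show thesis
  proof (rule that[of t])
    show "0 < t" by (fact t)
    show "t \<le> \<gamma>" using t \<delta> by simp
    fix h :: "real^'n \<Rightarrow> real"
    assume hyps: "continuous_on UNIV h" "\<forall>y. h y \<le> g y" "\<forall>y. g y \<le> 1 \<longrightarrow> g y - t \<le> h y"
    note h = hyps(1) hyps(2)[rule_format] and h3 = hyps(3)[rule_format]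
    have t1: "t \<le> 1" using t \<delta> by simp
    have D': "norm y \<le> D" if "g y \<le> t" for y using D t1 that by simp
    have h3': "g y - t \<le> h y" if "g y \<le> t" for y using h3 t1 that by simp
    obtain \<xi> N where \<xi>: "norm \<xi> \<le> \<epsilon> * D" "g \<xi> \<le> t" and N: "continuous_on UNIV N" "\<And>y. 0 \<le> N y"
      and lev: "\<And>\<sigma>. 0 < \<sigma> \<Longrightarrow> emeasure lebesgue {y. N y < \<sigma>} = emeasure lebesgue (ball (0::real^'n) \<sigma>)"
      and pb: "\<And>p y. \<lbrakk>\<And>z. h \<xi> + p \<bullet> (z - \<xi>) \<le> h z\<rbrakk> \<Longrightarrow> \<bar>p \<bullet> y\<bar> \<le> C1 * max t (g y)"
      and hb: "\<And>p y. \<lbrakk>\<And>z. h \<xi> + p \<bullet> (z - \<xi>) \<le> h z; N y < \<theta> * r\<rbrakk> \<Longrightarrow>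
       h y - h \<xi> - p \<bullet> (y - \<xi>) \<le> C2 * t * (N y / r)\<^sup>2"
      using convex_section_touching[OF g t(1) D' \<epsilon> r vol[unfolded d_def] h h3']
      unfolding d_def[symmetric] \<eta>_def[symmetric] C1_def C2_def \<theta>_def by blast
    have Nm[measurable]: "N \<in> borel_measurable lebesgue"
      using N(1) by (rule borel_measurable_lebesgue_continuous)
    define \<kappa> where "\<kappa> = ennreal ((\<theta> * r) powr e)"
    have \<theta>r: "0 < \<theta> * r" using \<theta> r by simp
    \<comment> \<open>\<open>J\<close> is adapted to the paraboloid and enters only where
      \<open>N y < \<theta> * r\<close>, the range of the quadratic bound; gluing dominates
      \<open>K'\<close> by the truncated \<open>K\<close> plus this part of
      \<open>J\<close>.\<close>
    define J where "J y = (if N y = 0 then top else ennreal (N y powr e))" for y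
    have J: "admissible_kernel s J"
      unfolding J_def e_def d_def by (rule gauge_kernel_admissible[OF N lev s(1)])
    obtain K' where K': "admissible_kernel s K'"
      "\<And>y. K' y \<le> min (K y) \<kappa> + J y * indicator {y. \<kappa> < J y} y"
      unfolding \<kappa>_def e_def d_def using admissible_kernel_glue[OF K J \<theta>r s(1)] by blast
    have J\<kappa>: "\<kappa> < J y \<longleftrightarrow> N y < \<theta> * r" for y
      unfolding \<kappa>_def J_def by (rule gauge_kernel_greater_iff[OF N(2) \<theta>r e])
    have "(\<integral>\<^sup>+y. ennreal (h y - h \<xi> - p \<bullet> (y - \<xi>)) * K' y \<partial>lebesgue)
            \<le> (\<integral>\<^sup>+y. ennreal (g y) * K y \<partial>lebesgue) + ennreal \<gamma>"
      if p: "\<And>z. h \<xi> + p \<bullet> (z - \<xi>) \<le> h z" for p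
    proof -
      have np: "norm p \<le> \<sigma>"
      proof (rule \<tau>(2))
        fix y
        have "\<bar>p \<bullet> y\<bar> \<le> C1 * max t (g y)" by (rule pb[OF p])
        also have "\<dots> \<le> C1 * max \<tau> (g y)" using C1 t \<delta> by (intro mult_left_mono max.mono) auto
        finally show "\<bar>p \<bullet> y\<bar> \<le> C1 * max \<tau> (g y)" .
      qed
      define f where "f y = h y - h \<xi> - p \<bullet> (y - \<xi>)" for y
      define m where "m y = min (\<sigma> * norm y) (C1 * g y)" for y
      have m0: "0 \<le> m y" for y using \<sigma> C1 g(2)[of y] by (simp add: m_def)
      \<comment> \<open>The contributions of order \<open>t\<close> are \<open>- h \<xi>\<close>,
        \<open>p \<bullet> \<xi>\<close> and the values of \<open>p \<bullet> y\<close> inside the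
        section. Outside the section, \<open>p \<bullet> y\<close> is bounded by
        \<open>m y\<close>.\<close>
      have f1: "f y \<le> g y + (1 + 2 * C1) * t + m y" for y
      proof -
        have "- h \<xi> \<le> t" using h3'[OF \<xi>(2)] g(2)[of \<xi>] by linarith
        moreover have "p \<bullet> \<xi> \<le> C1 * t" using pb[OF p, of \<xi>] \<xi>(2) by (simp add: max_def split: if_splits)
        moreover have "\<bar>p \<bullet> y\<bar> \<le> m y + C1 * t"
        proof (cases "t \<le> g y")
          case True
          have "\<bar>p \<bullet> y\<bar> \<le> norm p * norm y" by (rule Cauchy_Schwarz_ineq2)
          also have "\<dots> \<le> \<sigma> * norm y" using np by (intro mult_right_mono) auto
          finally have "\<bar>p \<bullet> y\<bar> \<le> m y" using pb[OF p, of y] True by (simp add: m_def max_def split: if_splits)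
          then show ?thesis using C1 t by (simp add: add_increasing2)
        next
          case False
          then have "\<bar>p \<bullet> y\<bar> \<le> C1 * t" using pb[OF p, of y] by (simp add: max_def split: if_splits)
          then show ?thesis using m0[of y] by linarith
        qed
        ultimately show ?thesis using h(2)[of y] by (simp add: f_def inner_diff_right algebra_simps)
      qed
      have f2: "ennreal (f y) * J y * indicator {y. \<kappa> < J y} y
          \<le> ennreal (C2 * t / r\<^sup>2) * (ennreal ((N y)\<^sup>2 * N y powr e) * indicator {y. N y < \<theta> * r} y)" for y
      proof (cases "N y < \<theta> * r")
        case True
        have fy: "f y \<le> C2 * t * (N y / r)\<^sup>2" unfolding f_def by (rule hb[OF p True])
        show ?thesis
        \<comment> \<open>Where \<open>N y = 0\<close> the quadratic bound makes \<open>f y\<close>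
          nonpositive, so the infinite value of \<open>J\<close> is multiplied by 0.\<close>
        proof (cases "N y = 0")
          case True
          then have "ennreal (f y) = 0" using fy by (simp add: ennreal_neg)
          then show ?thesis by simp
        next
          case False
          have "ennreal (f y) * J y \<le> ennreal (C2 * t * (N y / r)\<^sup>2) * ennreal (N y powr e)"
            using fy False by (auto simp: J_def intro!: mult_right_mono ennreal_leI)
          also have "\<dots> = ennreal (C2 * t / r\<^sup>2) * ennreal ((N y)\<^sup>2 * N y powr e)"
            using C2 t by (simp add: ennreal_mult[symmetric] power_divide)
          finally show ?thesis using \<open>N y < \<theta> * r\<close> J\<kappa> by simp
        qed
      next
        case False
        then show ?thesis using J\<kappa> by simp
      qed
      \<comment> \<open>The truncation is dropped in the terms with \<open>g\<close> and
        \<open>m\<close>, which are integrable against \<open>K\<close>. The constant term keeps it,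
        because \<open>K\<close> itself has infinite integral.\<close>
      have pt: "ennreal (f y) * K' y \<le> ennreal (g y) * K y
          + (ennreal ((1 + 2 * C1) * t) * min (K y) \<kappa> + (ennreal (m y) * K y
          + ennreal (C2 * t / r\<^sup>2) * (ennreal ((N y)\<^sup>2 * N y powr e) * indicator {y. N y < \<theta> * r} y)))" for y
      proof -
        have "ennreal (f y) * K' y \<le> ennreal (f y) * (min (K y) \<kappa> + J y * indicator {y. \<kappa> < J y} y)"
          by (intro mult_left_mono K') simp
        also have "\<dots> = ennreal (f y) * min (K y) \<kappa> + ennreal (f y) * J y * indicator {y. \<kappa> < J y} y"
          by (simp add: distrib_left mult.assoc)
        also have "\<dots> \<le> (ennreal (g y) + ennreal ((1 + 2 * C1) * t) + ennreal (m y)) * min (K y) \<kappa>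
           + ennreal (f y) * J y * indicator {y. \<kappa> < J y} y"
        proof (intro add_right_mono mult_right_mono)
          have "ennreal (f y) \<le> ennreal (g y + (1 + 2 * C1) * t + m y)" by (intro ennreal_leI f1)
          also have "\<dots> = ennreal (g y) + ennreal ((1 + 2 * C1) * t) + ennreal (m y)"
            using g(2)[of y] C1 t m0[of y] by (simp add: ennreal_plus)
          finally show "ennreal (f y) \<le> ennreal (g y) + ennreal ((1 + 2 * C1) * t) + ennreal (m y)" .
        qed simp
        also have "\<dots> = ennreal (g y) * min (K y) \<kappa> + (ennreal ((1 + 2 * C1) * t) * min (K y) \<kappa>
           + (ennreal (m y) * min (K y) \<kappa> + ennreal (f y) * J y * indicator {y. \<kappa> < J y} y))"
          by (simp add: distrib_right add.assoc)
        also have "\<dots> \<le> ennreal (g y) * K y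
          + (ennreal ((1 + 2 * C1) * t) * min (K y) \<kappa> + (ennreal (m y) * K y
          + ennreal (C2 * t / r\<^sup>2) * (ennreal ((N y)\<^sup>2 * N y powr e) * indicator {y. N y < \<theta> * r} y)))"
          by (intro add_mono mult_left_mono f2) auto
        finally show ?thesis .
      qed
      have Ns[measurable]: "{y. N y < \<theta> * r} \<in> sets lebesgue" by (intro sets_lebesgue_Collect_less) auto
      have mm[measurable]: "m \<in> borel_measurable lebesgue" unfolding m_def by measurable
      have I2: "ennreal ((1 + 2 * C1) * t) * (\<integral>\<^sup>+y. min (K y) \<kappa> \<partial>lebesgue) \<le> ennreal (X * \<delta>)"
      proof -
        have "ennreal ((1 + 2 * C1) * t) * (\<integral>\<^sup>+y. min (K y) \<kappa> \<partial>lebesgue)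
            \<le> ennreal ((1 + 2 * C1) * t) * ennreal (A * (\<theta> * r) powr (- s))"
          unfolding \<kappa>_def by (intro mult_left_mono A(2) K \<theta>r) simp
        also have "\<dots> = ennreal ((1 + 2 * C1) * t * (A * (\<theta> * r) powr (- s)))"
          using C1 t A(1) by (intro ennreal_mult[symmetric]) auto
        also have "(1 + 2 * C1) * t * (A * (\<theta> * r) powr (- s)) = X * (t * r powr (- s))"
          using \<theta> r by (simp add: X_def powr_mult)
        also have "ennreal \<dots> \<le> ennreal (X * \<delta>)" using t XY by (intro ennreal_leI mult_left_mono)
        finally show ?thesis .
      qed
      \<comment> \<open>The denominator \<open>r\<^sup>2\<close> turns \<open>r powr (2 - s)\<close>
        into \<open>r powr (- s)\<close>, the same power as in the height error, which
        \<open>t\<close> absorbs.\<close>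
      have I4: "ennreal (C2 * t / r\<^sup>2) * (\<integral>\<^sup>+y. ennreal ((N y)\<^sup>2 * N y powr e) * indicator {y. N y < \<theta> * r} y \<partial>lebesgue)
          \<le> ennreal (Y * \<delta>)"
      proof -
        have "ennreal (C2 * t / r\<^sup>2) * (\<integral>\<^sup>+y. ennreal ((N y)\<^sup>2 * N y powr e) * indicator {y. N y < \<theta> * r} y \<partial>lebesgue)
          \<le> ennreal (C2 * t / r\<^sup>2) * ennreal (B * (\<theta> * r) powr (2 - s))"
          by (intro mult_left_mono B(2) Nm N(2) \<theta>r lev) simp_all
        also have "\<dots> = ennreal (C2 * t / r\<^sup>2 * (B * (\<theta> * r) powr (2 - s)))"
          using C2 t B(1) by (intro ennreal_mult[symmetric]) auto
        also have "C2 * t / r\<^sup>2 * (B * (\<theta> * r) powr (2 - s)) = Y * (t * r powr (- s))"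
        proof -
          have "r powr (2 - s) = r\<^sup>2 * r powr (- s)"
            using r powr_add[of r 2 "- s"] by (simp add: powr_numeral)
          then show ?thesis using \<theta> r by (simp add: Y_def powr_mult)
        qed
        also have "ennreal \<dots> \<le> ennreal (Y * \<delta>)" using t XY by (intro ennreal_leI mult_left_mono)
        finally show ?thesis .
      qed
      have "(\<integral>\<^sup>+y. ennreal (f y) * K' y \<partial>lebesgue) \<le> (\<integral>\<^sup>+y. ennreal (g y) * K y
          + (ennreal ((1 + 2 * C1) * t) * min (K y) \<kappa> + (ennreal (m y) * K y
          + ennreal (C2 * t / r\<^sup>2) * (ennreal ((N y)\<^sup>2 * N y powr e) * indicator {y. N y < \<theta> * r} y))) \<partial>lebesgue)"
        by (intro nn_integral_mono pt)
      also have "\<dots> = (\<integral>\<^sup>+y. ennreal (g y) * K y \<partial>lebesgue)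
          + (ennreal ((1 + 2 * C1) * t) * (\<integral>\<^sup>+y. min (K y) \<kappa> \<partial>lebesgue)
          + ((\<integral>\<^sup>+y. ennreal (m y) * K y \<partial>lebesgue)
          + ennreal (C2 * t / r\<^sup>2) * (\<integral>\<^sup>+y. ennreal ((N y)\<^sup>2 * N y powr e) * indicator {y. N y < \<theta> * r} y \<partial>lebesgue)))"
        by (simp add: nn_integral_add nn_integral_cmult)
      also have "\<dots> \<le> (\<integral>\<^sup>+y. ennreal (g y) * K y \<partial>lebesgue)
          + (ennreal (X * \<delta>) + (ennreal (\<gamma> / 4) + ennreal (Y * \<delta>)))"
        using I2 I4 \<sigma>(2) unfolding m_def by (intro add_mono order_refl)
      also have "ennreal (X * \<delta>) + (ennreal (\<gamma> / 4) + ennreal (Y * \<delta>)) = ennreal (X * \<delta> + (\<gamma> / 4 + Y * \<delta>))"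
        using XY \<delta> \<gamma> by simp
      also have "\<dots> \<le> ennreal \<gamma>" using XY\<delta> \<gamma> by (intro ennreal_leI) simp
      finally show ?thesis unfolding f_def by (simp add: add_left_mono)
    qed
    then show "\<exists>\<xi>. norm \<xi> \<le> \<epsilon> * D \<and> (\<forall>p. (\<forall>z. h \<xi> + p \<bullet> (z - \<xi>) \<le> h z) \<longrightarrow>
        (\<exists>K'. admissible_kernel s K' \<and>
          (\<integral>\<^sup>+y. ennreal (h y - h \<xi> - p \<bullet> (y - \<xi>)) * K' y \<partial>lebesgue)
            \<le> (\<integral>\<^sup>+y. ennreal (g y) * K y \<partial>lebesgue) + ennreal \<gamma>))"
      using \<xi>(1) K'(1) by blast
  qed
qed

section \<open>Subgradients and the operator\<close>

text \<open>A hyperplane separates the point \<open>(x, f x)\<close> from the strict epigraph. It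
  cannot be vertical, since the epigraph projects onto the whole space, so dividing by its last
  coefficient gives a subgradient.\<close>

lemma convex_subdifferential_nonempty:
  fixes f :: "real^'n \<Rightarrow> real"
  assumes f: "convex_on UNIV f"
  shows "subdifferential f x \<noteq> {}"
proof -
  define E where "E = {(z, \<tau>) | z \<tau>. f z < \<tau>}"
  have "convex E"
  proof (rule convexI)
    fix a b :: "(real^'n) \<times> real" and v w :: real
    assume a: "a \<in> E" and b: "b \<in> E" and vw: "0 \<le> v" "0 \<le> w" "v + w = 1"
    have "f (v *\<^sub>R fst a + w *\<^sub>R fst b) \<le> v * f (fst a) + w * f (fst b)"
      using f vw by (simp add: convex_on_def)
    also have "\<dots> < v * snd a + w * snd b"
    proof (cases "v = 0")
      case True then show ?thesis using vw b by (auto simp: E_def)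
    next
      case False
      then have "v * f (fst a) < v * snd a" using a vw by (auto simp: E_def)
      moreover have "w * f (fst b) \<le> w * snd b" using b vw by (auto simp: E_def intro!: mult_left_mono)
      ultimately show ?thesis by linarith
    qed
    finally show "v *\<^sub>R a + w *\<^sub>R b \<in> E"
      by (cases a, cases b) (auto simp: E_def)
  qed
  moreover have "(x, f x + 1) \<in> E" "(x, f x) \<notin> E" by (auto simp: E_def)
  ultimately have "\<exists>a c. a \<noteq> 0 \<and> (\<forall>y\<in>{(x, f x)}. a \<bullet> y \<le> c) \<and> (\<forall>y\<in>E. c \<le> a \<bullet> y)"
    by (intro separating_hyperplane_sets) auto
  then obtain a c where a: "a \<noteq> 0" "a \<bullet> (x, f x) \<le> c" "\<And>y. y \<in> E \<Longrightarrow> c \<le> a \<bullet> y" by blast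
  obtain a1 a2 where a12: "a = (a1, a2)" by (cases a)
  have sep: "a1 \<bullet> x + a2 * f x \<le> a1 \<bullet> z + a2 * \<tau>" if "f z < \<tau>" for z \<tau>
    using a(2) a(3)[of "(z, \<tau>)"] that by (auto simp: a12 E_def)
  have a2: "0 \<le> a2" using sep[of x "f x + 1"] by (simp add: algebra_simps)
  have "a2 \<noteq> 0"
  proof
    assume "a2 = 0"
    then have "a1 \<bullet> x \<le> a1 \<bullet> z" for z using sep[of z "f z + 1"] by simp
    from this[of "x - a1"] have "a1 \<bullet> a1 \<le> 0" by (simp add: inner_diff_right)
    then have "a1 = 0" by (metis inner_gt_zero_iff not_less)
    then show False using a(1) \<open>a2 = 0\<close> by (simp add: a12 zero_prod_def)
  qed
  then have a2: "0 < a2" using a2 by simp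
  have "a1 \<bullet> x + a2 * f x \<le> a1 \<bullet> z + a2 * f z" for z
  proof (rule field_le_epsilon)
    fix e :: real assume "0 < e"
    then have "a1 \<bullet> x + a2 * f x \<le> a1 \<bullet> z + a2 * (f z + e / a2)" using a2 by (intro sep) simp
    also have "\<dots> = a1 \<bullet> z + a2 * f z + e" using a2 by (simp add: field_simps)
    finally show "a1 \<bullet> x + a2 * f x \<le> a1 \<bullet> z + a2 * f z + e" .
  qed
  then have "a2 * f z \<ge> a2 * (f x + (- (1 / a2) *\<^sub>R a1) \<bullet> (z - x))" for z
    using a2 by (simp add: inner_diff_right algebra_simps)
  then have "f x + (- (1 / a2) *\<^sub>R a1) \<bullet> (z - x) \<le> f z" for z using a2 by (simp add: mult_le_cancel_left_pos)
  then have "- (1 / a2) *\<^sub>R a1 \<in> subdifferential f x" unfolding subdifferential_def by simp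
  then show ?thesis by blast
qed

text \<open>The supporting affine function at the intermediate point is averaged over the two end
  points. This applies to sub-solutions, as a real lower bound on \<open>MA\<close> excludes an
  empty subdifferential.\<close>

lemma convex_on_if_subdifferentials_nonempty:
  fixes f :: "real^'n \<Rightarrow> real"
  assumes "\<And>x. subdifferential f x \<noteq> {}"
  shows "convex_on UNIV f"
proof (rule convex_onI)
  fix t :: real and x y :: "real^'n" assume t: "0 < t" "t < 1"
  define z where "z = (1 - t) *\<^sub>R x + t *\<^sub>R y"
  obtain b where b: "\<And>y. f z + b \<bullet> (y - z) \<le> f y"
    using assms[of z] by (auto simp: subdifferential_def)
  have "(1 - t) * (f z + b \<bullet> (x - z)) + t * (f z + b \<bullet> (y - z)) \<le> (1 - t) * f x + t * f y"
    using t b by (intro add_mono mult_left_mono) auto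
  moreover have "(1 - t) * (f z + b \<bullet> (x - z)) + t * (f z + b \<bullet> (y - z)) = f z + b \<bullet> ((1 - t) *\<^sub>R x + t *\<^sub>R y - z)"
    by (simp add: inner_diff_right inner_add_right algebra_simps)
  ultimately show "f ((1 - t) *\<^sub>R x + t *\<^sub>R y) \<le> (1 - t) * f x + t * f y" by (simp add: z_def)
qed simp

text \<open>The set is an intersection of closed half-spaces, and a unit step along a subgradient
  bounds its norm by the growth of \<open>f\<close> on the unit ball. The result guarantees extreme
  points of nonempty subdifferentials.\<close>

lemma subdifferential_compact_convex:
  fixes f :: "real^'n \<Rightarrow> real"
  assumes f: "continuous_on UNIV f"
  shows "compact (subdifferential f x)" "convex (subdifferential f x)"
proof -
  have eq: "subdifferential f x = (\<Inter>z. {b. (z - x) \<bullet> b \<le> f z - f x})"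
    by (auto simp: subdifferential_def inner_commute algebra_simps)
  show "convex (subdifferential f x)" unfolding eq by (intro convex_INT convex_halfspace_le)
  have "closed (subdifferential f x)" unfolding eq by (intro closed_INT ballI closed_halfspace_le)
  moreover have "bounded (subdifferential f x)"
  proof -
    have "\<exists>y\<in>cball x 1. \<forall>z\<in>cball x 1. f z \<le> f y"
      using continuous_on_subset[OF f] by (intro continuous_attains_sup) auto
    then obtain y where y: "\<And>z. z \<in> cball x 1 \<Longrightarrow> f z \<le> f y" by blast
    have "norm b \<le> f y - f x" if b: "b \<in> subdifferential f x" for b
    proof (cases "b = 0")
      case True then show ?thesis using y[of x] by simp
    next
      case False
      define z where "z = x + inverse (norm b) *\<^sub>R b"
      have "f x + b \<bullet> (z - x) \<le> f z" using b by (simp add: subdifferential_def)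
      moreover have "b \<bullet> (z - x) = norm b"
        using False by (simp add: z_def dot_square_norm power2_eq_square)
      moreover have "f z \<le> f y" using False by (intro y) (simp add: z_def dist_norm)
      ultimately show ?thesis by linarith
    qed
    then show ?thesis unfolding bounded_iff by blast
  qed
  ultimately show "compact (subdifferential f x)" by (simp add: compact_eq_bounded_closed)
qed

section \<open>Sign, comparison and near-optimal subgradients for \<open>MA\<close>\<close>

lemma MA_nonneg:
  assumes "subdifferential v x \<noteq> {}"
  shows "0 \<le> MA s v x"
proof -
  obtain b where "b \<in> subdifferential v x" using assms by blast
  then have "0 \<le> (SUP b \<in> subdifferential v x. INF K \<in> {K. admissible_kernel s K}.
              enn2ereal (\<integral>\<^sup>+ y. ennreal (v (x + y) - v x - y \<bullet> b) * K y \<partial>lebesgue))"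
    by (rule SUP_upper2) (auto intro!: INF_greatest)
  then show ?thesis using assms by (simp add: MA_def)
qed

text \<open>Subgradients of \<open>v\<close> at the contact point are subgradients of
  \<open>m\<close>, and the integrands increase.\<close>

lemma MA_mono_touching:
  assumes le: "\<And>z. v z \<le> m z" and eq: "v x = m x"
  shows "MA s v x \<le> MA s m x"
proof (cases "subdifferential v x = {}")
  case False
  have sub: "subdifferential v x \<subseteq> subdifferential m x"
    using le eq by (auto simp: subdifferential_def intro: order_trans)
  then have ne: "subdifferential m x \<noteq> {}" using False by blast
  have "(SUP b \<in> subdifferential v x. INF K \<in> {K. admissible_kernel s K}.
              enn2ereal (\<integral>\<^sup>+ y. ennreal (v (x + y) - v x - y \<bullet> b) * K y \<partial>lebesgue))
    \<le> (SUP b \<in> subdifferential m x. INF K \<in> {K. admissible_kernel s K}.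
              enn2ereal (\<integral>\<^sup>+ y. ennreal (m (x + y) - m x - y \<bullet> b) * K y \<partial>lebesgue))"
  proof (rule SUP_mono)
    fix b assume b: "b \<in> subdifferential v x"
    have "(INF K \<in> {K. admissible_kernel s K}.
              enn2ereal (\<integral>\<^sup>+ y. ennreal (v (x + y) - v x - y \<bullet> b) * K y \<partial>lebesgue))
      \<le> (INF K \<in> {K. admissible_kernel s K}.
              enn2ereal (\<integral>\<^sup>+ y. ennreal (m (x + y) - m x - y \<bullet> b) * K y \<partial>lebesgue))"
    proof (rule INF_mono)
      fix K assume "K \<in> {K :: real^'a \<Rightarrow> ennreal. admissible_kernel s K}"
      moreover have "(\<integral>\<^sup>+ y. ennreal (v (x + y) - v x - y \<bullet> b) * K y \<partial>lebesgue)
          \<le> (\<integral>\<^sup>+ y. ennreal (m (x + y) - m x - y \<bullet> b) * K y \<partial>lebesgue)"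
        using le eq by (intro nn_integral_mono mult_right_mono ennreal_leI) (auto simp: eq)
      ultimately show "\<exists>K'\<in>{K. admissible_kernel s K}.
          enn2ereal (\<integral>\<^sup>+ y. ennreal (v (x + y) - v x - y \<bullet> b) * K' y \<partial>lebesgue)
          \<le> enn2ereal (\<integral>\<^sup>+ y. ennreal (m (x + y) - m x - y \<bullet> b) * K y \<partial>lebesgue)"
        by (auto simp: less_eq_ennreal.rep_eq)
    qed
    then show "\<exists>b'\<in>subdifferential m x. (INF K \<in> {K. admissible_kernel s K}.
              enn2ereal (\<integral>\<^sup>+ y. ennreal (v (x + y) - v x - y \<bullet> b) * K y \<partial>lebesgue))
      \<le> (INF K \<in> {K. admissible_kernel s K}.
              enn2ereal (\<integral>\<^sup>+ y. ennreal (m (x + y) - m x - y \<bullet> b') * K y \<partial>lebesgue))"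
      using sub b by blast
  qed
  then show ?thesis using False ne by (simp add: MA_def)
qed (simp add: MA_def)

text \<open>The strict inequality yields one subgradient that serves all kernels, even if the
  supremum is not attained.\<close>

lemma MA_greater_obtains_subgradient:
  fixes v :: "real^'n \<Rightarrow> real"
  assumes "ereal c < MA s v x"
  obtains b where "b \<in> subdifferential v x"
    "\<And>K. admissible_kernel s K \<Longrightarrow>
      ereal c \<le> enn2ereal (\<integral>\<^sup>+ y. ennreal (v (x + y) - v x - y \<bullet> b) * K y \<partial>lebesgue)"
proof -
  have "subdifferential v x \<noteq> {}" using assms by (auto simp: MA_def)
  then have "ereal c < (SUP b \<in> subdifferential v x. INF K \<in> {K. admissible_kernel s K}.
              enn2ereal (\<integral>\<^sup>+ y. ennreal (v (x + y) - v x - y \<bullet> b) * K y \<partial>lebesgue))"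
    using assms by (simp add: MA_def)
  then obtain b where b: "b \<in> subdifferential v x" and
    inf: "ereal c < (INF K \<in> {K. admissible_kernel s K}.
              enn2ereal (\<integral>\<^sup>+ y. ennreal (v (x + y) - v x - y \<bullet> b) * K y \<partial>lebesgue))"
    unfolding less_SUP_iff by blast
  have "ereal c \<le> enn2ereal (\<integral>\<^sup>+ y. ennreal (v (x + y) - v x - y \<bullet> b) * K y \<partial>lebesgue)"
    if "admissible_kernel s K" for K
  proof (rule less_imp_le, rule less_le_trans[OF inf])
    show "(INF K \<in> {K. admissible_kernel s K}.
        enn2ereal (\<integral>\<^sup>+ y. ennreal (v (x + y) - v x - y \<bullet> b) * K y \<partial>lebesgue))
      \<le> enn2ereal (\<integral>\<^sup>+ y. ennreal (v (x + y) - v x - y \<bullet> b) * K y \<partial>lebesgue)"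
      by (rule INF_lower) (use that in simp)
  qed
  then show thesis using that b by blast
qed

section \<open>Directions of recession and bounded sections\<close>

lemma strictly_convex_gap_below_line:
  fixes \<phi> :: "real^'n \<Rightarrow> real"
  assumes \<phi>: "strictly_convex \<phi>" and e: "e \<noteq> 0"
    and below: "\<And>\<mu>. 0 \<le> \<mu> \<Longrightarrow> \<phi> (x + \<mu> *\<^sub>R e) \<le> \<alpha> + \<beta> * \<mu>"
  obtains c where "0 < c" "\<And>\<mu>. 1 \<le> \<mu> \<Longrightarrow> \<phi> (x + \<mu> *\<^sub>R e) + c \<le> \<alpha> + \<beta> * \<mu>"
proof -
  \<comment> \<open>\<open>H\<close> is strictly concave along the line and nonnegative on the
    half-line, so it is positive at 1 and cannot fall back towards 0.\<close>
  define H where "H \<mu> = \<alpha> + \<beta> * \<mu> - \<phi> (x + \<mu> *\<^sub>R e)" for \<mu>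
  have H0: "0 \<le> H \<mu>" if "0 \<le> \<mu>" for \<mu> using below[OF that] by (simp add: H_def)
  have mid: "(H l1 + H l2) / 2 < H ((l1 + l2) / 2)" if "l1 \<noteq> l2" for l1 l2
  proof -
    have "x + l1 *\<^sub>R e \<noteq> x + l2 *\<^sub>R e" using that e by simp
    then have "\<phi> ((1 - 1/2) *\<^sub>R (x + l1 *\<^sub>R e) + (1/2) *\<^sub>R (x + l2 *\<^sub>R e))
        < (1 - 1/2) * \<phi> (x + l1 *\<^sub>R e) + (1/2) * \<phi> (x + l2 *\<^sub>R e)"
      using \<phi>[unfolded strictly_convex_def, rule_format, of "x + l1 *\<^sub>R e" "x + l2 *\<^sub>R e" "1/2"] by simp
    moreover have "(1 - 1/2) *\<^sub>R (x + l1 *\<^sub>R e) + (1/2) *\<^sub>R (x + l2 *\<^sub>R e) = x + ((l1 + l2) / 2) *\<^sub>R e"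
      by (simp add: vec_eq_iff field_simps)
    ultimately show ?thesis by (simp add: H_def field_simps)
  qed
  have H1: "0 < H 1" using mid[of 0 2] H0[of 0] H0[of 2] by simp
  \<comment> \<open>\<open>\<mu>\<close> is the midpoint of 1 and \<open>2 * \<mu> - 1\<close>;
    working with midpoints only costs the factor 2.\<close>
  have H2: "H 1 / 2 \<le> H \<mu>" if \<mu>: "1 \<le> \<mu>" for \<mu>
  proof (cases "\<mu> = 1")
    case False
    then show ?thesis using mid[of 1 "2 * \<mu> - 1"] H0[of "2 * \<mu> - 1"] \<mu> by simp
  qed (use H1 in simp)
  have "\<phi> (x + \<mu> *\<^sub>R e) + H 1 / 2 \<le> \<alpha> + \<beta> * \<mu>" if "1 \<le> \<mu>" for \<mu>
    using H2[OF that] unfolding H_def[of \<mu>] by linarith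
  then show thesis using that[of "H 1 / 2"] H1 by simp
qed

text \<open>The directions of an unbounded sequence in the sublevel set accumulate at some
  \<open>l\<close>. Convexity from the origin makes \<open>g\<close> at distance
  \<open>\<mu>\<close> along these directions at most \<open>\<mu> / k\<close>, so \<open>g\<close>
  is nonpositive on the ray through \<open>l\<close>.\<close>

lemma convex_sublevel_bounded:
  fixes g :: "'a::euclidean_space \<Rightarrow> real"
  assumes g: "convex_on UNIV g" "g 0 = 0"
    and noray: "\<And>e. norm e = 1 \<Longrightarrow> \<exists>\<mu>\<ge>0. 0 < g (\<mu> *\<^sub>R e)"
  obtains D where "0 \<le> D" "\<And>y. g y \<le> 1 \<Longrightarrow> norm y \<le> D"
proof (rule ccontr)
  assume neg: "\<not> thesis"
  have "\<exists>y. g y \<le> 1 \<and> real k < norm y" for k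
    using neg that[of "real k"] not_le by auto
  then obtain y where y: "\<And>k. g (y k) \<le> 1" "\<And>k. real k < norm (y k)" by metis
  have y0: "0 < norm (y k)" for k using y(2)[of k] by (meson le_less_trans of_nat_0_le_iff)
  define e where "e k = inverse (norm (y k)) *\<^sub>R y k" for k
  have "e k \<in> sphere 0 1" for k using y0[of k] by (simp add: e_def)
  moreover have "compact (sphere (0::'a) 1)" by simp
  ultimately obtain l \<phi> where l: "l \<in> sphere 0 1" "strict_mono \<phi>" "(e \<circ> \<phi>) \<longlonglongrightarrow> l"
    unfolding compact_def by metis
  have contg: "continuous_on UNIV g" using g(1) by (intro convex_on_continuous) auto
  obtain \<mu> where \<mu>: "0 \<le> \<mu>" "0 < g (\<mu> *\<^sub>R l)" using noray[of l] l(1) by auto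
  have "g (\<mu> *\<^sub>R l) \<le> 0"
  proof (rule LIMSEQ_le)
    have "isCont g (\<mu> *\<^sub>R l)" using contg by (simp add: continuous_on_eq_continuous_at)
    moreover have "(\<lambda>k. \<mu> *\<^sub>R e (\<phi> k)) \<longlonglongrightarrow> \<mu> *\<^sub>R l" using l(3) by (intro tendsto_intros) (simp add: o_def)
    ultimately show "(\<lambda>k. g (\<mu> *\<^sub>R e (\<phi> k))) \<longlonglongrightarrow> g (\<mu> *\<^sub>R l)" by (rule isCont_tendsto_compose)
    have "(\<lambda>k. \<mu> * inverse (real (Suc k))) \<longlonglongrightarrow> \<mu> * 0"
      by (intro tendsto_intros LIMSEQ_inverse_real_of_nat)
    then show "(\<lambda>k. \<mu> * (inverse (real k))) \<longlonglongrightarrow> 0"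
      by (subst (asm) filterlim_sequentially_Suc) simp
    show "\<exists>n0. \<forall>k\<ge>n0. g (\<mu> *\<^sub>R e (\<phi> k)) \<le> \<mu> * inverse (real k)"
    \<comment> \<open>From this index on, \<open>\<mu>\<close> is less than the norm of
      \<open>y (\<phi> k)\<close>, so the evaluated point lies between the origin and
      \<open>y (\<phi> k)\<close>; \<open>Suc\<close> also keeps \<open>k\<close> positive.\<close>
    proof (intro exI[of _ "Suc (nat \<lceil>\<mu>\<rceil>)"] allI impI)
      fix k assume k: "Suc (nat \<lceil>\<mu>\<rceil>) \<le> k"
      define n where "n = norm (y (\<phi> k))"
      have "real k \<le> real (\<phi> k)" using seq_suble[OF l(2)] by simp
      then have n: "real k < n" using y(2)[of "\<phi> k"] unfolding n_def by linarith
      have k0: "0 < real k" using k by simp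
      have "\<mu> \<le> n" using k n by linarith
      define v where "v = \<mu> / n"
      have v: "0 \<le> v" "v \<le> 1" using \<mu> n k0 \<open>\<mu> \<le> n\<close> by (auto simp: v_def)
      have "\<mu> *\<^sub>R e (\<phi> k) = (1 - v) *\<^sub>R 0 + v *\<^sub>R y (\<phi> k)" by (simp add: e_def v_def n_def divide_inverse)
      then have "g (\<mu> *\<^sub>R e (\<phi> k)) \<le> (1 - v) * g 0 + v * g (y (\<phi> k))"
        using convex_onD[OF g(1), of v 0 "y (\<phi> k)"] v by simp
      also have "\<dots> \<le> v" using v y(1)[of "\<phi> k"] g(2) by (simp add: mult_left_le)
      also have "\<dots> \<le> \<mu> * inverse (real k)"
        unfolding v_def divide_inverse using \<mu> n k0 by (intro mult_left_mono le_imp_inverse_le) auto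
      finally show "g (\<mu> *\<^sub>R e (\<phi> k)) \<le> \<mu> * inverse (real k)" .
    qed
  qed
  then show False using \<mu> by simp
qed

section \<open>The Perron function\<close>

lemma strictly_convex_imp_convex_on:
  fixes \<phi> :: "real^'n \<Rightarrow> real"
  assumes "strictly_convex \<phi>"
  shows "convex_on UNIV \<phi>"
proof (rule convex_onI)
  fix t :: real and x y :: "real^'n" assume t: "0 < t" "t < 1"
  show "\<phi> ((1 - t) *\<^sub>R x + t *\<^sub>R y) \<le> (1 - t) * \<phi> x + t * \<phi> y"
  proof (cases "x = y")
    case True
    have "(1 - t) *\<^sub>R y + t *\<^sub>R y = y" by (simp add: scaleR_left_distrib[symmetric])
    then show ?thesis using True by (simp add: algebra_simps)
  next
    case False
    then show ?thesis using assms t unfolding strictly_convex_def by (meson less_imp_le)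
  qed
qed simp

text \<open>For \<open>\<phi>\<close> itself the sub-solution inequality reads
  \<open>0 \<le> MA\<close>, which follows from having a subgradient. This makes the class
  nonempty.\<close>

lemma convex_in_perron_class:
  assumes "convex_on UNIV \<phi>" "\<forall>x. 0 \<le> w x"
  shows "\<phi> \<in> perron_class s \<phi> w"
  using assms MA_nonneg[OF convex_subdifferential_nonempty[OF assms(1)]]
  by (simp add: perron_class_def zero_ereal_def[symmetric])

lemma perron_class_convex:
  assumes "v \<in> perron_class s \<phi> w"
  shows "convex_on UNIV v"
proof (rule convex_on_if_subdifferentials_nonempty)
  fix x
  have "ereal (v x - \<phi> x) \<le> MA s v x" using assms by (simp add: perron_class_def)
  then show "subdifferential v x \<noteq> {}" by (auto simp: MA_def)
qed

text \<open>At each point the maximum is touched from below by the larger of the two functions,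
  whose inequality it inherits there.\<close>

lemma perron_class_max:
  assumes v: "v1 \<in> perron_class s \<phi> w" "v2 \<in> perron_class s \<phi> w"
  shows "(\<lambda>x. max (v1 x) (v2 x)) \<in> perron_class s \<phi> w"
proof -
  let ?m = "\<lambda>x. max (v1 x) (v2 x)"
  have "ereal (?m x - \<phi> x) \<le> MA s ?m x" for x
  proof (cases "v2 x \<le> v1 x")
    case True
    then have "ereal (?m x - \<phi> x) \<le> MA s v1 x" using v by (simp add: perron_class_def)
    also have "\<dots> \<le> MA s ?m x" using True by (intro MA_mono_touching) auto
    finally show ?thesis .
  next
    case False
    then have "ereal (?m x - \<phi> x) \<le> MA s v2 x" using v by (simp add: perron_class_def)
    also have "\<dots> \<le> MA s ?m x" using False by (intro MA_mono_touching) auto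
    finally show ?thesis .
  qed
  then show ?thesis using v by (simp add: perron_class_def le_max_iff_disj)
qed

lemma perron_class_finite_upper_bound:
  assumes "finite F" "F \<subseteq> perron_class s \<phi> w" "perron_class s \<phi> w \<noteq> {}"
  shows "\<exists>v\<in>perron_class s \<phi> w. \<forall>f\<in>F. \<forall>x. f x \<le> v x"
  using assms
proof (induction F rule: finite_induct)
  case (insert f F)
  then obtain v where v: "v \<in> perron_class s \<phi> w" "\<forall>f\<in>F. \<forall>x. f x \<le> v x" by auto
  have "f \<in> perron_class s \<phi> w" using insert by simp
  from perron_class_max[OF this v(1)] show ?case
    by (rule bexI[rotated]) (use v in \<open>auto intro: max.coboundedI2\<close>)
qed auto

section \<open>The Perron function as a supremum of convex functions\<close>

context
  fixes s :: real and \<phi> w :: "real^'n \<Rightarrow> real"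
  assumes \<phi>conv: "convex_on UNIV \<phi>" and w0: "\<forall>x. 0 \<le> w x"
begin

lemma perron_upper: "v \<in> perron_class s \<phi> w \<Longrightarrow> v x \<le> perron s \<phi> w x"
  unfolding perron_def
  by (rule cSUP_upper) (auto simp: perron_class_def intro!: bdd_aboveI[of _ "\<phi> x + w x"])

lemma perron_least: "(\<And>v. v \<in> perron_class s \<phi> w \<Longrightarrow> v x \<le> c) \<Longrightarrow> perron s \<phi> w x \<le> c"
  unfolding perron_def using convex_in_perron_class[OF \<phi>conv w0] by (intro cSUP_least) auto

lemma perron_bounds: "\<phi> x \<le> perron s \<phi> w x" "perron s \<phi> w x \<le> \<phi> x + w x"
  using perron_upper[OF convex_in_perron_class[OF \<phi>conv w0]]
  by (auto intro!: perron_least simp: perron_class_def)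

lemma perron_convex: "convex_on UNIV (perron s \<phi> w)"
proof (rule convex_onI)
  fix t :: real and x y :: "real^'n" assume t: "0 < t" "t < 1"
  show "perron s \<phi> w ((1 - t) *\<^sub>R x + t *\<^sub>R y) \<le> (1 - t) * perron s \<phi> w x + t * perron s \<phi> w y"
  proof (rule perron_least)
    fix v assume v: "v \<in> perron_class s \<phi> w"
    have "v ((1 - t) *\<^sub>R x + t *\<^sub>R y) \<le> (1 - t) * v x + t * v y"
      using convex_onD[OF perron_class_convex[OF v]] t by simp
    also have "\<dots> \<le> (1 - t) * perron s \<phi> w x + t * perron s \<phi> w y"
      using perron_upper[OF v] t by (intro add_mono mult_left_mono) auto
    finally show "v ((1 - t) *\<^sub>R x + t *\<^sub>R y) \<le> (1 - t) * perron s \<phi> w x + t * perron s \<phi> w y" .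
  qed
qed simp

text \<open>Convex functions are continuous, so the sets where a member exceeds the Perron function
  minus \<open>\<kappa>\<close> form an open cover of \<open>C\<close>; a finite subcover is
  replaced by a common upper bound in the class.\<close>

lemma perron_approx_on_compact:
  assumes C: "compact C" and \<kappa>: "0 < \<kappa>"
  shows "\<exists>v\<in>perron_class s \<phi> w. \<forall>x\<in>C. perron s \<phi> w x - \<kappa> \<le> v x"
proof -
  let ?P = "perron_class s \<phi> w" and ?u = "perron s \<phi> w"
  let ?U = "\<lambda>v. {x. ?u x - \<kappa> < v x}"
  have contu: "continuous_on UNIV ?u" using perron_convex by (intro convex_on_continuous) auto
  have op: "open (?U v)" if "v \<in> ?P" for v
    using contu convex_on_continuous[OF open_UNIV perron_class_convex[OF that]]
    by (intro open_Collect_less continuous_intros)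
  have cover: "C \<subseteq> (\<Union>v\<in>?P. ?U v)"
  proof
    fix x
    have "\<not> ?u x \<le> ?u x - \<kappa>" using \<kappa> by simp
    then obtain v where "v \<in> ?P" "\<not> v x \<le> ?u x - \<kappa>" using perron_least[of x "?u x - \<kappa>"] by blast
    then show "x \<in> (\<Union>v\<in>?P. ?U v)" by (auto simp: not_le)
  qed
  obtain F where F: "F \<subseteq> ?P" "finite F" "C \<subseteq> (\<Union>v\<in>F. ?U v)"
    using compactE_image[OF C op cover] by blast
  obtain v where v: "v \<in> ?P" "\<forall>f\<in>F. \<forall>x. f x \<le> v x"
    using perron_class_finite_upper_bound[OF F(2,1)] convex_in_perron_class[OF \<phi>conv w0] by blast
  have "?u x - \<kappa> \<le> v x" if x: "x \<in> C" for x
  proof -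
    obtain f where "f \<in> F" "?u x - \<kappa> < f x" using F(3) x by blast
    then show ?thesis using v(2) by (meson less_imp_le order_trans)
  qed
  then show ?thesis using v(1) by blast
qed

end

text \<open>Along a contact ray \<open>u\<close> is affine, so strict convexity keeps
  \<open>\<phi>\<close> a fixed distance below it, whereas \<open>u - \<phi> \<le> w\<close> and the
  bound on \<open>w\<close> tends to 0 at infinity because \<open>s > 1\<close>.\<close>

lemma no_contact_ray:
  fixes \<phi> w u :: "real^'n \<Rightarrow> real"
  assumes \<phi>: "strictly_convex \<phi>" and bounds: "\<And>x. \<phi> x \<le> u x" "\<And>x. u x \<le> \<phi> x + w x"
    and w: "\<And>x. w x \<le> C * (1 + norm x) powr (1 - s)" and s: "1 < s"
    and b: "b \<in> subdifferential u x0" and e: "norm e = 1"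
  shows "\<exists>\<mu>\<ge>0. 0 < u (x0 + \<mu> *\<^sub>R e) - u x0 - b \<bullet> (\<mu> *\<^sub>R e)"
proof (rule ccontr)
  assume neg: "\<not> ?thesis"
  have line: "u (x0 + \<mu> *\<^sub>R e) = u x0 + (b \<bullet> e) * \<mu>" if "0 \<le> \<mu>" for \<mu>
  proof -
    have "u x0 + b \<bullet> (x0 + \<mu> *\<^sub>R e - x0) \<le> u (x0 + \<mu> *\<^sub>R e)"
      using b unfolding subdifferential_def by blast
    moreover have "u (x0 + \<mu> *\<^sub>R e) - u x0 - b \<bullet> (\<mu> *\<^sub>R e) \<le> 0" using neg that by (auto simp: not_less)
    ultimately show ?thesis by (simp add: mult.commute)
  qed
  have e0: "e \<noteq> 0" using e by auto
  have "\<phi> (x0 + \<mu> *\<^sub>R e) \<le> u x0 + (b \<bullet> e) * \<mu>" if "0 \<le> \<mu>" for \<mu>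
    using bounds(1)[of "x0 + \<mu> *\<^sub>R e"] line[OF that] by simp
  then obtain c where c: "0 < c" "\<And>\<mu>. 1 \<le> \<mu> \<Longrightarrow> \<phi> (x0 + \<mu> *\<^sub>R e) + c \<le> u x0 + (b \<bullet> e) * \<mu>"
    using strictly_convex_gap_below_line[OF \<phi> e0, of x0 "u x0" "b \<bullet> e"] by blast
  have low: "c \<le> C * (1 + norm (x0 + \<mu> *\<^sub>R e)) powr (1 - s)" if "1 \<le> \<mu>" for \<mu>
    using c(2)[OF that] line[of \<mu>] bounds(2)[of "x0 + \<mu> *\<^sub>R e"] w[of "x0 + \<mu> *\<^sub>R e"] that by simp
  have "filterlim (\<lambda>\<mu>. 1 + norm (x0 + \<mu> *\<^sub>R e)) at_top at_top"
  proof (rule filterlim_at_top_mono)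
    show "filterlim (\<lambda>\<mu>. (1 - norm x0) + \<mu>) at_top (at_top::real filter)"
      by (intro filterlim_tendsto_add_at_top[OF tendsto_const] filterlim_ident)
    show "\<forall>\<^sub>F \<mu> in at_top. (1 - norm x0) + \<mu> \<le> 1 + norm (x0 + \<mu> *\<^sub>R e)"
      using eventually_ge_at_top[of 0]
    proof eventually_elim
      case (elim \<mu>)
      then show ?case using norm_diff_ineq[of "\<mu> *\<^sub>R e" x0] e by (simp add: add.commute)
    qed
  qed
  then have "((\<lambda>\<mu>. (1 + norm (x0 + \<mu> *\<^sub>R e)) powr (1 - s)) \<longlongrightarrow> 0) at_top"
    using s by (intro tendsto_neg_powr) auto
  then have "((\<lambda>\<mu>. C * (1 + norm (x0 + \<mu> *\<^sub>R e)) powr (1 - s)) \<longlongrightarrow> 0) at_top"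
    by (rule tendsto_mult_right_zero)
  moreover have "\<forall>\<^sub>F \<mu> in at_top. c \<le> C * (1 + norm (x0 + \<mu> *\<^sub>R e)) powr (1 - s)"
    using eventually_ge_at_top[of 1] by eventually_elim (rule low)
  ultimately have "c \<le> 0" by (rule tendsto_lowerbound) simp
  then show False using c(1) by simp
qed

text \<open>The bound makes \<open>b + p / C\<close> and \<open>b - p / C\<close> subgradients, and
  \<open>b\<close> is their midpoint.\<close>

lemma extreme_subgradient_rigid:
  assumes b: "b extreme_point_of subdifferential u x0" and C: "0 < C"
    and p: "\<And>y. \<bar>p \<bullet> y\<bar> \<le> C * (u (x0 + y) - u x0 - b \<bullet> y)"
  shows "p = 0"
proof (rule ccontr)
  assume "p \<noteq> 0"
  define q where "q = (1 / C) *\<^sub>R p"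
  have "q \<noteq> 0" using \<open>p \<noteq> 0\<close> C by (simp add: q_def)
  have q: "\<bar>q \<bullet> y\<bar> \<le> u (x0 + y) - u x0 - b \<bullet> y" for y
    using p[of y] C by (simp add: q_def abs_mult field_simps)
  have "b + q \<in> subdifferential u x0" "b - q \<in> subdifferential u x0"
    unfolding subdifferential_def
  proof (safe)
    fix z
    show "u x0 + (b + q) \<bullet> (z - x0) \<le> u z" "u x0 + (b - q) \<bullet> (z - x0) \<le> u z"
      using q[of "z - x0"] by (simp_all add: inner_add_left inner_diff_left)
  qed
  moreover have "b = midpoint (b - q) (b + q)" by (simp add: midpoint_def vec_eq_iff)
  moreover have "b - q \<noteq> b + q"
  proof
    assume "b - q = b + q"
    then have "q + q = 0" by (simp add: algebra_simps)
    then show False using \<open>q \<noteq> 0\<close> by (simp add: vec_eq_iff)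
  qed
  ultimately show False
    using b midpoint_in_open_segment[of "b - q" "b + q"] unfolding extreme_point_of_def by metis
qed

theorem lemma5p7:
  fixes s :: real and \<phi> \<Phi> w u :: "real^'n \<Rightarrow> real"
  assumes s: "1 < s" "s < 2"
    and \<phi>: "standing_assms \<phi> \<Phi>"
    and w_def: "is_frac_resolvent s (frac_lap s \<phi>) (\<lambda>x. - w x)"
    and w_cont: "continuous_on UNIV w"
    and w_bounds: "\<exists>C. \<forall>x. 0 \<le> w x \<and> w x \<le> C * (1 + norm x) powr (1 - s)"
    and w_super: "\<forall>x. MA s (\<lambda>z. \<phi> z + w z) x \<le> ereal (w x)"
    and u: "u = perron s \<phi> w"
  shows "\<forall>x. MA s u x \<ge> ereal (u x - \<phi> x)"
proof
  fix x0
  obtain C where w0: "\<forall>x. 0 \<le> w x" and wC: "\<And>x. w x \<le> C * (1 + norm x) powr (1 - s)"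
    using w_bounds by blast
  have s0: "0 < s" using s by simp
  have sc: "strictly_convex \<phi>" using \<phi> by (simp add: standing_assms_def)
  have \<phi>conv: "convex_on UNIV \<phi>" by (rule strictly_convex_imp_convex_on[OF sc])
  note perron = perron_upper[OF \<phi>conv w0, where s=s, folded u]
    perron_bounds[OF \<phi>conv w0, where s=s, folded u]
  have uconv: "convex_on UNIV u" unfolding u by (rule perron_convex[OF \<phi>conv w0])
  have contu: "continuous_on UNIV u" and cont\<phi>: "continuous_on UNIV \<phi>"
    using uconv \<phi>conv by (auto intro: convex_on_continuous)
  \<comment> \<open>\<open>MA\<close> is a supremum over subgradients, so a single well-chosen one
    suffices for a lower bound.\<close>
  obtain b where bext: "b extreme_point_of subdifferential u x0"
    using extreme_point_exists_convex[OF subdifferential_compact_convex[OF contu]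
        convex_subdifferential_nonempty[OF uconv]] by blast
  then have b: "b \<in> subdifferential u x0" by (simp add: extreme_point_of_def)
  define g where "g y = u (x0 + y) - u x0 - b \<bullet> y" for y
  have g0: "g 0 = 0" by (simp add: g_def)
  have gnn: "0 \<le> g y" for y
  proof -
    have "u x0 + b \<bullet> (x0 + y - x0) \<le> u (x0 + y)" using b unfolding subdifferential_def by blast
    then show ?thesis by (simp add: g_def)
  qed
  have gconv: "convex_on UNIV g"
  proof (rule convex_onI)
    fix t :: real and x y :: "real^'n" assume t: "0 < t" "t < 1"
    have "x0 + ((1 - t) *\<^sub>R x + t *\<^sub>R y) = (1 - t) *\<^sub>R (x0 + x) + t *\<^sub>R (x0 + y)"
      by (simp add: algebra_simps)
    then have "u (x0 + ((1 - t) *\<^sub>R x + t *\<^sub>R y)) \<le> (1 - t) * u (x0 + x) + t * u (x0 + y)"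
      using convex_onD[OF uconv, of t "x0 + x" "x0 + y"] t by simp
    then show "g ((1 - t) *\<^sub>R x + t *\<^sub>R y) \<le> (1 - t) * g x + t * g y"
      by (simp add: g_def inner_add_right algebra_simps)
  qed simp
  obtain D where D: "0 \<le> D" "\<forall>y. g y \<le> 1 \<longrightarrow> norm y \<le> D"
    using convex_sublevel_bounded[OF gconv g0]
      no_contact_ray[OF sc perron(2,3) wC s(1) b] unfolding g_def by blast
  have rigid: "\<forall>p C. 0 < C \<longrightarrow> (\<forall>y. \<bar>p \<bullet> y\<bar> \<le> C * g y) \<longrightarrow> p = 0"
    using extreme_subgradient_rigid[OF bext] unfolding g_def by blast
  define c where "c = u x0 - \<phi> x0"
  have key: "ereal c \<le> enn2ereal (\<integral>\<^sup>+y. ennreal (g y) * K y \<partial>lebesgue)" if K: "admissible_kernel s K" for K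
  proof (cases "(\<integral>\<^sup>+y. ennreal (g y) * K y \<partial>lebesgue) < \<infinity>")
    case False
    then show ?thesis by (simp add: not_less top_unique)
  next
    case fin: True
    then obtain I where I: "0 \<le> I" "(\<integral>\<^sup>+y. ennreal (g y) * K y \<partial>lebesgue) = ennreal I"
      by (cases "\<integral>\<^sup>+y. ennreal (g y) * K y \<partial>lebesgue") auto
    \<comment> \<open>Four losses of at most \<open>\<gamma>\<close> each: selecting a subgradient
      of \<open>v\<close>, the kernel estimate, the approximation of \<open>u\<close> by
      \<open>v\<close>, and the variation of \<open>u - \<phi>\<close> near
      \<open>x0\<close>.\<close>
    have "c \<le> I + 4 * \<gamma>" if \<gamma>: "0 < \<gamma>" for \<gamma>
    proof -
      have "isCont (\<lambda>\<xi>. u (x0 + \<xi>) - \<phi> (x0 + \<xi>)) 0"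
        by (rule continuous_on_interior[of UNIV])
          (auto intro!: continuous_intros continuous_on_compose2[OF contu] continuous_on_compose2[OF cont\<phi>])
      then obtain \<delta> where \<delta>: "0 < \<delta>" "\<And>\<xi>. norm \<xi> < \<delta> \<Longrightarrow> \<bar>u (x0 + \<xi>) - \<phi> (x0 + \<xi>) - c\<bar> < \<gamma>"
        using \<gamma> unfolding continuous_at_eps_delta by (force simp: dist_norm c_def)
      \<comment> \<open>Ensures \<open>\<epsilon> * D < \<delta>\<close>, which puts the touching
        point within the continuity radius; \<open>D + 1\<close> guards against
        \<open>D = 0\<close>.\<close>
      define \<epsilon> where "\<epsilon> = min 1 (\<delta> / (2 * (D + 1)))"
      have \<epsilon>: "0 < \<epsilon>" "\<epsilon> \<le> 1" using \<delta> D by (auto simp: \<epsilon>_def)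
      have "\<epsilon> * D \<le> \<delta> / (2 * (D + 1)) * (D + 1)" using D \<delta> by (intro mult_mono) (auto simp: \<epsilon>_def)
      also have "\<dots> = \<delta> / 2" using D by (simp add: field_simps)
      finally have \<epsilon>D: "\<epsilon> * D < \<delta>" using \<delta> by simp
      have \<epsilon>D1: "\<epsilon> * D \<le> D" using \<epsilon> D by (simp add: mult_left_le_one_le)
      obtain t where t: "0 < t" "t \<le> \<gamma>" and est:
        "\<And>h. \<lbrakk>continuous_on UNIV h; \<forall>y. h y \<le> g y; \<forall>y. g y \<le> 1 \<longrightarrow> g y - t \<le> h y\<rbrakk> \<Longrightarrow>
          \<exists>\<xi>. norm \<xi> \<le> \<epsilon> * D \<and> (\<forall>p. (\<forall>z. h \<xi> + p \<bullet> (z - \<xi>) \<le> h z) \<longrightarrow>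
            (\<exists>K'. admissible_kernel s K' \<and>
              (\<integral>\<^sup>+y. ennreal (h y - h \<xi> - p \<bullet> (y - \<xi>)) * K' y \<partial>lebesgue)
                \<le> (\<integral>\<^sup>+y. ennreal (g y) * K y \<partial>lebesgue) + ennreal \<gamma>))"
        using touching_kernel_estimate[OF s0 s(2) K gconv gnn g0 fin rigid D(2) \<epsilon> \<gamma>] by blast
      \<comment> \<open>The ball contains the translated section \<open>g \<le> 1\<close>, so
        \<open>v\<close> is accurate to within \<open>t\<close> wherever the estimate demands
        it.\<close>
      obtain v where v: "v \<in> perron_class s \<phi> w" and vu: "\<And>x. x \<in> cball x0 D \<Longrightarrow> u x - t \<le> v x"
        using perron_approx_on_compact[OF \<phi>conv w0 compact_cball t(1), of s x0 D] unfolding u by blast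
      \<comment> \<open>\<open>v\<close> is recentred at \<open>x0\<close> and reduced by the same
        affine function as in \<open>g\<close>, so subgradients of \<open>h\<close> are those of
        \<open>v\<close> shifted by \<open>- b\<close>.\<close>
      define h where "h y = v (x0 + y) - u x0 - b \<bullet> y" for y
      have conth: "continuous_on UNIV h"
        unfolding h_def
        by (intro continuous_intros
            continuous_on_compose2[OF convex_on_continuous[OF open_UNIV perron_class_convex[OF v]]]) auto
      have hg: "h y \<le> g y" for y using perron(1)[OF v, of "x0 + y"] by (simp add: h_def g_def)
      have gh: "g y - t \<le> h y" if "norm y \<le> D" for y
        using vu[of "x0 + y"] that by (simp add: h_def g_def dist_norm)
      obtain \<xi> where \<xi>: "norm \<xi> \<le> \<epsilon> * D" and \<xi>K: "\<And>p. (\<And>z. h \<xi> + p \<bullet> (z - \<xi>) \<le> h z) \<Longrightarrow>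
          \<exists>K'. admissible_kernel s K' \<and>
            (\<integral>\<^sup>+y. ennreal (h y - h \<xi> - p \<bullet> (y - \<xi>)) * K' y \<partial>lebesgue)
              \<le> (\<integral>\<^sup>+y. ennreal (g y) * K y \<partial>lebesgue) + ennreal \<gamma>"
        using est[OF conth] hg gh D(2) by blast
      define x1 where "x1 = x0 + \<xi>"
      have "ereal (v x1 - \<phi> x1 - \<gamma>) < ereal (v x1 - \<phi> x1)" using \<gamma> by simp
      also have "\<dots> \<le> MA s v x1" using v by (simp add: perron_class_def)
      finally obtain b1 where b1: "b1 \<in> subdifferential v x1" and b1K:
        "\<And>K. admissible_kernel s K \<Longrightarrow> ereal (v x1 - \<phi> x1 - \<gamma>)
          \<le> enn2ereal (\<integral>\<^sup>+ y. ennreal (v (x1 + y) - v x1 - y \<bullet> b1) * K y \<partial>lebesgue)"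
        by (rule MA_greater_obtains_subgradient) blast
      define p where "p = b1 - b"
      have "h \<xi> + p \<bullet> (z - \<xi>) \<le> h z" for z
      proof -
        have "v x1 + b1 \<bullet> (x0 + z - x1) \<le> v (x0 + z)" using b1 unfolding subdifferential_def by blast
        then show ?thesis by (simp add: h_def p_def x1_def inner_diff_left inner_diff_right)
      qed
      then obtain K' where K': "admissible_kernel s K'" and K'I:
        "(\<integral>\<^sup>+y. ennreal (h y - h \<xi> - p \<bullet> (y - \<xi>)) * K' y \<partial>lebesgue) \<le> ennreal I + ennreal \<gamma>"
        using \<xi>K[of p] I(2) by auto
      define F where "F y = ennreal (h y - h \<xi> - p \<bullet> (y - \<xi>)) * K' y" for y
      have Fm: "F \<in> borel_measurable lebesgue"
      proof -
        note [measurable] = admissible_kernel_measurable[OF K']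
        have [measurable]: "(\<lambda>y. h y - h \<xi> - p \<bullet> (y - \<xi>)) \<in> borel_measurable lebesgue"
          by (intro borel_measurable_lebesgue_continuous continuous_intros conth)
        show ?thesis unfolding F_def by measurable
      qed
      \<comment> \<open>Translating the kernel by \<open>\<xi>\<close> moves the integral for
        \<open>v\<close> at \<open>x1\<close> back to the base point \<open>x0\<close>, where the
        estimate for \<open>h\<close> is formulated.\<close>
      have "ereal (v x1 - \<phi> x1 - \<gamma>)
          \<le> enn2ereal (\<integral>\<^sup>+ y. ennreal (v (x1 + y) - v x1 - y \<bullet> b1) * K' (\<xi> + y) \<partial>lebesgue)"
        by (rule b1K[OF admissible_kernel_translation[OF K']])
      also have "(\<integral>\<^sup>+ y. ennreal (v (x1 + y) - v x1 - y \<bullet> b1) * K' (\<xi> + y) \<partial>lebesgue) = (\<integral>\<^sup>+ y. F (\<xi> + y) \<partial>lebesgue)"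
        by (simp add: F_def h_def p_def x1_def inner_diff_left inner_add_right inner_commute algebra_simps)
      also have "\<dots> = (\<integral>\<^sup>+ y. F y \<partial>lebesgue)" by (rule nn_integral_lebesgue_translation[OF Fm])
      also have "enn2ereal \<dots> \<le> enn2ereal (ennreal I + ennreal \<gamma>)"
        using K'I unfolding F_def by (simp only: less_eq_ennreal.rep_eq)
      also have "ennreal I + ennreal \<gamma> = ennreal (I + \<gamma>)" using I \<gamma> by simp
      also have "enn2ereal \<dots> = ereal (I + \<gamma>)" using I \<gamma> by (intro enn2ereal_ennreal) simp
      finally have "v x1 - \<phi> x1 - \<gamma> \<le> I + \<gamma>" by simp
      moreover have "u x1 - t \<le> v x1" using \<xi> \<epsilon>D1 by (intro vu) (simp add: x1_def dist_norm)
      moreover have "\<bar>u x1 - \<phi> x1 - c\<bar> < \<gamma>" unfolding x1_def using \<xi> \<epsilon>D by (intro \<delta>(2)) simp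
      ultimately show ?thesis using t(2) by linarith
    qed
    note le = this
    have "c \<le> I"
    proof (rule field_le_epsilon)
      fix e :: real assume "0 < e"
      then show "c \<le> I + e" using le[of "e / 4"] by simp
    qed
    then show ?thesis using I by (simp add: enn2ereal_ennreal)
  qed
  have "ereal c \<le> (INF K \<in> {K. admissible_kernel s K}.
      enn2ereal (\<integral>\<^sup>+ y. ennreal (u (x0 + y) - u x0 - y \<bullet> b) * K y \<partial>lebesgue))"
    using key unfolding g_def by (intro INF_greatest) (simp add: inner_commute)
  also have "\<dots> \<le> (SUP b \<in> subdifferential u x0. INF K \<in> {K. admissible_kernel s K}.
      enn2ereal (\<integral>\<^sup>+ y. ennreal (u (x0 + y) - u x0 - y \<bullet> b) * K y \<partial>lebesgue))"
    using b by (rule SUP_upper)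
  also have "\<dots> = MA s u x0" using b by (auto simp: MA_def)
  finally show "MA s u x0 \<ge> ereal (u x0 - \<phi> x0)" unfolding c_def .
qed

end
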